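(* Let $K=1$, so that the single attribute $X$ is both public and private, and let there be no side information. Let $(D_1,E_1)$ and $(D_2,E_2)$ be distortion-privacy pairs with $D_2<D_1$ and $E_2<E_1$. Successive disclosure with pairs $(D_1,E_1)$ and $(D_2,E_2)$ is achievable if and only if there exists a conditional distribution $p(\hat x_1,\hat x_2|x)$ such that: (i) $\mathbb{E}[g(X,\hat X_k)]\le D_k$ for $k=1,2$; (ii) $R(D_k,E_k)=I(X;\hat X_k)$ for $k=1,2$; (iii) $X-\hat X_2-\hat X_1$ is a Markov chain, i.e. $p(\hat x_1,\hat x_2|x)=p(\hat x_2|x)\,p(\hat x_1|\hat x_2)$.
   Context: The source is $X^n$, i.i.d. with a known pmf on a finite alphabet, and $g$ is a per-letter distortion function. The rate-distortion-equivocation function is $R(D,E)=\inf\{I(X;\hat X): p(\hat x|x)\text{ with }\mathbb{E}[g(X,\hat X)]\le D,\ H(X|\hat X)\ge E\}$. It is the minimal rate of a code $W=F_E(X^n)$, $\hat X^n=F_D(W)$ satisfying $\mathbb{E}[\frac1n\sum_i g(X_i,\hat X_i)]\le D+\epsilon$ and $\frac1n H(X^n|W)\ge E-\epsilon$ asymptotically. Successive disclosure: a two-stage code consists of a first message $W_1$ of rate $R_1$ and a second message $W_2$ of rate $\Delta R$, both functions of $X^n$. A first decoder forms $\hat X_1^n$ from $W_1$, and a second decoder forms $\hat X_2^n$ from $(W_1,W_2)$. The requirements are $\mathbb{E}[\frac1n\sum_i g(X_i,\hat X_{k,i})]\le D_k+\epsilon$ for $k=1,2$, together with $\frac1n H(X^n|W_1)\ge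 E_1-\epsilon$ and $\frac1n H(X^n|W_1,W_2)\ge E_2-\epsilon$. Successive disclosure with pairs $(D_1,E_1),(D_2,E_2)$ is achievable if such codes exist for every $\epsilon>0$ with no rate loss, meaning $R_1=R(D_1,E_1)$ and $R_1+\Delta R=R(D_2,E_2)$. *)

theory Defs
  imports Complex_Main
begin

definition pmf_on :: "('a::finite \<Rightarrow> real) \<Rightarrow> bool" where
  "pmf_on P \<longleftrightarrow> (\<forall>x. 0 \<le> P x) \<and> sum P UNIV = 1"

definition channel :: "('a \<Rightarrow> 'b::finite \<Rightarrow> real) \<Rightarrow> bool" where
  "channel W \<longleftrightarrow> (\<forall>x y. 0 \<le> W x y) \<and> (\<forall>x. sum (W x) UNIV = 1)"

definition out_dist :: "('a::finite \<Rightarrow> real) \<Rightarrow> ('a \<Rightarrow> 'b \<Rightarrow> real) \<Rightarrow> 'b \<Rightarrow> real" where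
  "out_dist P W y = (\<Sum>x\<in>UNIV. P x * W x y)"

definition mutual_info :: "('a::finite \<Rightarrow> real) \<Rightarrow> ('a \<Rightarrow> 'b::finite \<Rightarrow> real) \<Rightarrow> real" where
  "mutual_info P W = (\<Sum>x\<in>UNIV. \<Sum>y\<in>UNIV. P x * W x y * log 2 (W x y / out_dist P W y))"

definition cond_entropy :: "('a::finite \<Rightarrow> real) \<Rightarrow> ('a \<Rightarrow> 'b::finite \<Rightarrow> real) \<Rightarrow> real" where
  "cond_entropy P W = (\<Sum>x\<in>UNIV. \<Sum>y\<in>UNIV. P x * W x y * log 2 (out_dist P W y / (P x * W x y)))"

definition exp_dist :: "('a::finite \<Rightarrow> real) \<Rightarrow> ('a \<Rightarrow> 'b::finite \<Rightarrow> real) \<Rightarrow> ('a \<Rightarrow> 'b \<Rightarrow> real) \<Rightarrow> real" where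
  "exp_dist P W g = (\<Sum>x\<in>UNIV. \<Sum>y\<in>UNIV. P x * W x y * g x y)"

definition rde_feasible :: "('a::finite \<Rightarrow> real) \<Rightarrow> ('a \<Rightarrow> 'b::finite \<Rightarrow> real) \<Rightarrow> real \<Rightarrow> real \<Rightarrow> bool" where
  "rde_feasible P g D E \<longleftrightarrow>
     (\<exists>W :: 'a \<Rightarrow> 'b \<Rightarrow> real. channel W \<and> exp_dist P W g \<le> D \<and> cond_entropy P W \<ge> E)"

definition RDE :: "('a::finite \<Rightarrow> real) \<Rightarrow> ('a \<Rightarrow> 'b::finite \<Rightarrow> real) \<Rightarrow> real \<Rightarrow> real \<Rightarrow> real" where
  "RDE P g D E = Inf {mutual_info P W | W :: 'a \<Rightarrow> 'b \<Rightarrow> real.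
                        channel W \<and> exp_dist P W g \<le> D \<and> cond_entropy P W \<ge> E}"

definition seq_prob :: "('a \<Rightarrow> real) \<Rightarrow> 'a list \<Rightarrow> real" where
  "seq_prob P xs = prod_list (map P xs)"

definition block_cond_entropy :: "('a \<Rightarrow> real) \<Rightarrow> nat \<Rightarrow> ('a list \<Rightarrow> 'm) \<Rightarrow> real" where
  "block_cond_entropy P n f =
     (\<Sum>xs\<in>{xs. length xs = n}.
        seq_prob P xs *
        log 2 ((\<Sum>ys\<in>{ys. length ys = n \<and> f ys = f xs}. seq_prob P ys) / seq_prob P xs))"

definition block_dist :: "('a \<Rightarrow> real) \<Rightarrow> ('a \<Rightarrow> 'b \<Rightarrow> real) \<Rightarrow> nat \<Rightarrow> ('a list \<Rightarrow> 'b list) \<Rightarrow> real" where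
  "block_dist P g n dec =
     (\<Sum>xs\<in>{xs. length xs = n}. seq_prob P xs * ((\<Sum>i<n. g (xs ! i) (dec xs ! i)) / real n))"

definition two_stage_achievable ::
  "('a::finite \<Rightarrow> real) \<Rightarrow> ('a \<Rightarrow> 'b::finite \<Rightarrow> real) \<Rightarrow> real \<Rightarrow> real \<Rightarrow>
   real \<Rightarrow> real \<Rightarrow> real \<Rightarrow> real \<Rightarrow> bool" where
  "two_stage_achievable P g R1 DR D1 E1 D2 E2 \<longleftrightarrow>
     (\<forall>\<epsilon>>0. \<forall>\<^sub>F n in sequentially.
        \<exists>(M1::nat) (M2::nat) (f1 :: 'a list \<Rightarrow> nat) (f2 :: 'a list \<Rightarrow> nat)
          (\<phi>1 :: nat \<Rightarrow> 'b list) (\<phi>2 :: nat \<Rightarrow> nat \<Rightarrow> 'b list).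
          (\<forall>xs. length xs = n \<longrightarrow> f1 xs < M1 \<and> f2 xs < M2) \<and>
          real M1 \<le> 2 powr (real n * (R1 + \<epsilon>)) \<and>
          real M2 \<le> 2 powr (real n * (DR + \<epsilon>)) \<and>
          (\<forall>w. length (\<phi>1 w) = n) \<and> (\<forall>w v. length (\<phi>2 w v) = n) \<and>
          block_dist P g n (\<lambda>xs. \<phi>1 (f1 xs)) \<le> D1 + \<epsilon> \<and>
          block_dist P g n (\<lambda>xs. \<phi>2 (f1 xs) (f2 xs)) \<le> D2 + \<epsilon> \<and>
          block_cond_entropy P n f1 / real n \<ge> E1 - \<epsilon> \<and>
          block_cond_entropy P n (\<lambda>xs. (f1 xs, f2 xs)) / real n \<ge> E2 - \<epsilon>)"

text \<open>Successive disclosure with no rate loss: R1 = R(D1,E1), R1 + DR = R(D2,E2).\<close>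
definition successive_disclosure_achievable ::
  "('a::finite \<Rightarrow> real) \<Rightarrow> ('a \<Rightarrow> 'b::finite \<Rightarrow> real) \<Rightarrow> real \<Rightarrow> real \<Rightarrow> real \<Rightarrow> real \<Rightarrow> bool" where
  "successive_disclosure_achievable P g D1 E1 D2 E2 \<longleftrightarrow>
     two_stage_achievable P g (RDE P g D1 E1) (RDE P g D2 E2 - RDE P g D1 E1) D1 E1 D2 E2"

definition cond_pmf2 :: "('a \<Rightarrow> 'b::finite \<Rightarrow> 'b \<Rightarrow> real) \<Rightarrow> bool" where
  "cond_pmf2 Q \<longleftrightarrow> (\<forall>x y1 y2. 0 \<le> Q x y1 y2) \<and> (\<forall>x. (\<Sum>y1\<in>UNIV. \<Sum>y2\<in>UNIV. Q x y1 y2) = 1)"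

definition marg1 :: "('a \<Rightarrow> 'b::finite \<Rightarrow> 'b \<Rightarrow> real) \<Rightarrow> 'a \<Rightarrow> 'b \<Rightarrow> real" where
  "marg1 Q x y1 = (\<Sum>y2\<in>UNIV. Q x y1 y2)"

definition marg2 :: "('a \<Rightarrow> 'b::finite \<Rightarrow> 'b \<Rightarrow> real) \<Rightarrow> 'a \<Rightarrow> 'b \<Rightarrow> real" where
  "marg2 Q x y2 = (\<Sum>y1\<in>UNIV. Q x y1 y2)"

text \<open>X - Xhat2 - Xhat1 is a Markov chain under the joint law P(x) Q(x,y1,y2):
  p(x,y2,y1) p(y2) = p(x,y2) p(y2,y1) for all x, y1, y2.\<close>
definition markov_X_Y2_Y1 :: "('a::finite \<Rightarrow> real) \<Rightarrow> ('a \<Rightarrow> 'b::finite \<Rightarrow> 'b \<Rightarrow> real) \<Rightarrow> bool" where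
  "markov_X_Y2_Y1 P Q \<longleftrightarrow>
     (\<forall>x y1 y2.
        P x * Q x y1 y2 * (\<Sum>x'\<in>UNIV. \<Sum>y1'\<in>UNIV. P x' * Q x' y1' y2)
        = (\<Sum>y1'\<in>UNIV. P x * Q x y1' y2) * (\<Sum>x'\<in>UNIV. P x' * Q x' y1 y2))"

end

theory Submission
  imports Defs "HOL-Analysis.Cartesian_Euclidean_Space" "HOL-Real_Asymp.Real_Asymp"
begin

text \<open>Since \<open>H(X|Y) = H(X) - I(X;Y)\<close>, the equivocation constraint only bounds the rate from above:
  feasibility gives \<open>R(D,E) \<le> H(X) - E\<close>, so a code of rate at most \<open>R(D,E)\<close> meets the equivocation
  demand automatically, and what remains is successive refinement.

  For the converse, Gibbs' inequality against the product of the backward channel bounds the rate of a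
  block code by the mutual information of its position-averaged channel. Applied to the first
  reproduction and to the pair of reproductions, and combined with compactness of the set of channels,
  it yields a limit \<open>Q\<close> with \<open>I(X;Y1) \<le> R(D1,E1)\<close> and \<open>I(X;Y1,Y2) \<le> R(D2,E2) \<le> I(X;Y2)\<close>. Equality in the
  data processing inequality is the Markov condition.

  For achievability, a derandomised two-layer random code (cloud centres for \<open>Y1\<close>, satellites for
  \<open>Y2\<close>) of rates slightly above \<open>I(X;Y1)\<close> and \<open>I(X;Y1,Y2) - I(X;Y1)\<close> covers all but a vanishing part of
  the source, and the Markov condition makes \<open>I(X;Y1,Y2)\<close> equal to \<open>I(X;Y2)\<close>.\<close>

subsection \<open>Product distributions on words\<close>

text \<open>Two obstacles shape the details. First, the equalities in (ii) are exact, whereas a code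
  of tolerance \<epsilon> only produces a channel within \<epsilon> of the optimum, and
  \<open>RDE\<close> is a bare infimum. The converse therefore has to produce a channel that attains
  two infima at once; this is why it keeps both reproductions in one joint law and needs mutual
  information to be continuous up to the boundary of the simplex. Second, all sums range over full
  alphabets, including letters of probability zero. Terms of zero mass vanish through their factor,
  so every logarithmic identity is proved on the support of the joint law and the rest is split off.
  In the direct part the probability space of codebooks is replaced by finite weighted averages.
  Covering is a one-shot statement about finite sets and two change-of-measure constants; the
  blocklength enters only when these constants become 2^(n(I + \<delta>)). A message set larger by a
  factor 2^(n \<delta>) then makes the covering errors doubly exponentially small, and the Chebyshev
  term of order 1/n dominates.\<close>

abbreviation words :: "nat \<Rightarrow> 'c list set" where
  "words n \<equiv> {xs. length xs = n}"

lemma finite_words [simp]: "finite (words n :: 'c::finite list set)"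
  using finite_lists_length_eq[of "UNIV :: 'c set" n] by simp

lemma sum_words_Suc:
  fixes F :: "'c::finite list \<Rightarrow> real"
  shows "(\<Sum>xs\<in>words (Suc n). F xs) = (\<Sum>x\<in>UNIV. \<Sum>xs\<in>words n. F (x # xs))"
proof -
  have "words (Suc n) = (\<lambda>(x, xs). x # xs) ` ((UNIV :: 'c set) \<times> words n)"
    by (auto simp: length_Suc_conv image_iff)
  moreover have "inj_on (\<lambda>(x, xs). x # xs) ((UNIV :: 'c set) \<times> words n)"
    by (auto simp: inj_on_def)
  ultimately show ?thesis
    by (simp add: sum.reindex sum.cartesian_product case_prod_unfold)
qed

lemma sum_UNIV_prod:
  fixes F :: "'c::finite \<times> 'd::finite \<Rightarrow> real"
  shows "(\<Sum>z\<in>UNIV. F z) = (\<Sum>x\<in>UNIV. \<Sum>y\<in>UNIV. F (x, y))"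
  by (simp add: sum.cartesian_product flip: UNIV_Times_UNIV)

text \<open>Applied twice, this merges a sum over three words into one over words of triples, on
  which the joint law is a product.\<close>

lemma sum_words_zip:
  fixes F :: "('c::finite \<times> 'd::finite) list \<Rightarrow> real"
  shows "(\<Sum>xs\<in>words n. \<Sum>ys\<in>words n. F (zip xs ys)) = (\<Sum>zs\<in>words n. F zs)"
proof (induction n arbitrary: F)
  case 0
  then show ?case by simp
next
  case (Suc n)
  have "(\<Sum>xs\<in>words (Suc n). \<Sum>ys\<in>words (Suc n). F (zip xs ys))
      = (\<Sum>x\<in>UNIV. \<Sum>xs\<in>words n. \<Sum>y\<in>UNIV. \<Sum>ys\<in>words n. F ((x, y) # zip xs ys))"
    by (simp add: sum_words_Suc)
  also have "\<dots> = (\<Sum>x\<in>UNIV. \<Sum>y\<in>UNIV. \<Sum>xs\<in>words n. \<Sum>ys\<in>words n. F ((x, y) # zip xs ys))"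
    by (intro sum.cong refl) (rule sum.swap)
  also have "\<dots> = (\<Sum>x\<in>UNIV. \<Sum>y\<in>UNIV. \<Sum>zs\<in>words n. F ((x, y) # zs))"
    by (intro sum.cong refl) (rule Suc.IH)
  also have "\<dots> = (\<Sum>zs\<in>words (Suc n). F zs)"
    by (simp add: sum_words_Suc sum_UNIV_prod)
  finally show ?case .
qed

lemma seq_prob_simps [simp]:
  "seq_prob P [] = 1" "seq_prob P (x # xs) = P x * seq_prob P xs"
  by (simp_all add: seq_prob_def)

lemma seq_prob_one: "seq_prob (\<lambda>_. 1) xs = 1"
  by (induction xs) auto

lemma seq_prob_nonneg: "(\<And>x. 0 \<le> P x) \<Longrightarrow> 0 \<le> seq_prob P xs"
  by (induction xs) auto

lemma seq_prob_le_one: "(\<And>x. 0 \<le> P x) \<Longrightarrow> (\<And>x. P x \<le> 1) \<Longrightarrow> seq_prob P xs \<le> 1"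
  by (induction xs) (auto intro!: mult_le_one seq_prob_nonneg)

lemma seq_prob_pos_iff:
  assumes "\<And>x. 0 \<le> P x"
  shows "0 < seq_prob P xs \<longleftrightarrow> (\<forall>x\<in>set xs. 0 < P x)"
proof (induction xs)
  case (Cons a xs)
  then show ?case
    using assms[of a] seq_prob_nonneg[of P xs] assms by (auto simp: zero_less_mult_iff)
qed simp

lemma seq_prob_mult:
  "seq_prob (\<lambda>z. F z * G z) zs = seq_prob F zs * seq_prob G zs"
  by (induction zs) (auto simp: algebra_simps)

lemma seq_prob_map: "seq_prob F (map h zs) = seq_prob (\<lambda>z. F (h z)) zs"
  by (simp add: seq_prob_def comp_def)

lemma seq_prob_cong: "(\<And>z. z \<in> set zs \<Longrightarrow> F z = G z) \<Longrightarrow> seq_prob F zs = seq_prob G zs"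
  by (induction zs) auto

lemma seq_prob_pos: "(\<And>z. z \<in> set zs \<Longrightarrow> 0 < F z) \<Longrightarrow> 0 < seq_prob F zs"
  by (induction zs) auto

lemma log_seq_prob:
  assumes "\<And>z. z \<in> set zs \<Longrightarrow> 0 < F z"
  shows "log 2 (seq_prob F zs) = sum_list (map (\<lambda>z. log 2 (F z)) zs)"
  using assms
proof (induction zs)
  case (Cons a zs)
  then have "0 < seq_prob F zs"
    by (intro seq_prob_pos) auto
  moreover have "0 < F a" using Cons.prems by simp
  moreover have "log 2 (seq_prob F zs) = sum_list (map (\<lambda>z. log 2 (F z)) zs)"
    using Cons.prems by (intro Cons.IH) auto
  ultimately show ?case by (simp add: log_mult)
qed simp

text \<open>Distributivity: marginalising a product law is done letter by letter. With different
  \<open>J\<close> it yields marginals of the joint word law, normalisation of product kernels, and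
  the mass bound for the backward channel.\<close>

lemma sum_seq_prob_zip:
  fixes J :: "'c \<times> 'd::finite \<Rightarrow> real"
  shows "(\<Sum>ys\<in>words (length zs). seq_prob J (zip zs ys)) = seq_prob (\<lambda>z. \<Sum>y\<in>UNIV. J (z, y)) zs"
proof (induction zs)
  case (Cons z zs)
  have "(\<Sum>ys\<in>words (length (z # zs)). seq_prob J (zip (z # zs) ys))
      = (\<Sum>y\<in>UNIV. \<Sum>ys\<in>words (length zs). J (z, y) * seq_prob J (zip zs ys))"
    by (simp add: sum_words_Suc)
  also have "\<dots> = (\<Sum>y\<in>UNIV. J (z, y)) * (\<Sum>ys\<in>words (length zs). seq_prob J (zip zs ys))"
    by (simp add: sum_product)
  finally show ?case using Cons.IH by simp
qed simp

lemma sum_seq_prob: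
  fixes P :: "'c::finite \<Rightarrow> real"
  shows "(\<Sum>xs\<in>words n. seq_prob P xs) = (sum P UNIV) ^ n"
proof (induction n)
  case (Suc n)
  then show ?case
    by (simp add: sum_words_Suc flip: sum_distrib_left sum_distrib_right)
qed simp

lemma sum_seq_prob_pmf:
  "pmf_on P \<Longrightarrow> (\<Sum>xs\<in>words n. seq_prob P xs) = 1"
  by (simp add: sum_seq_prob pmf_on_def)

lemma expectation_sum_list:
  fixes P :: "'c::finite \<Rightarrow> real"
  assumes "pmf_on P"
  shows "(\<Sum>xs\<in>words n. seq_prob P xs * sum_list (map f xs)) = real n * (\<Sum>x\<in>UNIV. P x * f x)"
proof (induction n)
  case (Suc n)
  have "(\<Sum>xs\<in>words (Suc n). seq_prob P xs * sum_list (map f xs))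
     = (\<Sum>x\<in>UNIV. P x * f x * (\<Sum>xs\<in>words n. seq_prob P xs)
          + P x * (\<Sum>xs\<in>words n. seq_prob P xs * sum_list (map f xs)))"
    by (simp add: sum_words_Suc algebra_simps sum.distrib sum_distrib_left)
  also have "\<dots> = (\<Sum>x\<in>UNIV. P x * f x) + sum P UNIV * (real n * (\<Sum>x\<in>UNIV. P x * f x))"
    by (simp add: Suc.IH sum_seq_prob_pmf[OF assms] sum.distrib sum_distrib_right)
  finally show ?case using assms by (simp add: pmf_on_def algebra_simps)
qed simp

text \<open>Splitting off the first letter leaves a cross term proportional to the mean, which is
  zero.\<close>

lemma variance_sum_list:
  fixes P :: "'c::finite \<Rightarrow> real"
  assumes "pmf_on P" and mean: "(\<Sum>x\<in>UNIV. P x * f x) = 0"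
  shows "(\<Sum>xs\<in>words n. seq_prob P xs * (sum_list (map f xs))\<^sup>2) = real n * (\<Sum>x\<in>UNIV. P x * (f x)\<^sup>2)"
proof (induction n)
  case (Suc n)
  have "(\<Sum>xs\<in>words (Suc n). seq_prob P xs * (sum_list (map f xs))\<^sup>2)
     = (\<Sum>x\<in>UNIV. P x * (f x)\<^sup>2 * (\<Sum>xs\<in>words n. seq_prob P xs)
          + 2 * (P x * f x) * (\<Sum>xs\<in>words n. seq_prob P xs * sum_list (map f xs))
          + P x * (\<Sum>xs\<in>words n. seq_prob P xs * (sum_list (map f xs))\<^sup>2))"
    by (simp add: sum_words_Suc algebra_simps sum.distrib sum_distrib_left power2_eq_square)
  also have "\<dots> = (\<Sum>x\<in>UNIV. P x * (f x)\<^sup>2) + sum P UNIV * (real n * (\<Sum>x\<in>UNIV. P x * (f x)\<^sup>2))"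
    by (simp add: Suc.IH sum_seq_prob_pmf[OF assms(1)] expectation_sum_list[OF assms(1)] mean
        sum.distrib sum_distrib_right)
  finally show ?case using assms by (simp add: pmf_on_def algebra_simps)
qed simp

text \<open>The event is one-sided because every typicality condition below, on information
  densities as on distortions, is an upper bound on an empirical average.\<close>

lemma chebyshev_sum_list:
  fixes P f :: "'c::finite \<Rightarrow> real"
  assumes P: "pmf_on P" and "0 < \<delta>" and "0 < n"
  defines "\<mu> \<equiv> (\<Sum>x\<in>UNIV. P x * f x)"
  shows "(\<Sum>xs\<in>{xs\<in>words n. sum_list (map f xs) > real n * (\<mu> + \<delta>)}. seq_prob P xs)
          \<le> (\<Sum>x\<in>UNIV. P x * (f x - \<mu>)\<^sup>2) / (real n * \<delta>\<^sup>2)"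
proof -
  let ?h = "\<lambda>x. f x - \<mu>"
  let ?B = "{xs\<in>words n. sum_list (map f xs) > real n * (\<mu> + \<delta>)}"
  have nonneg: "0 \<le> seq_prob P xs" for xs
    using P by (intro seq_prob_nonneg) (simp add: pmf_on_def)
  have mean: "(\<Sum>x\<in>UNIV. P x * ?h x) = 0"
  proof -
    have "(\<Sum>x\<in>UNIV. P x * ?h x) = \<mu> - sum P UNIV * \<mu>"
      by (simp add: \<mu>_def right_diff_distrib sum_subtractf flip: sum_distrib_right)
    then show ?thesis using P by (simp add: pmf_on_def)
  qed
  have centred: "sum_list (map ?h xs) = sum_list (map f xs) - real (length xs) * \<mu>" for xs
    by (induction xs) (auto simp: algebra_simps)
  have "(real n * \<delta>)\<^sup>2 * (\<Sum>xs\<in>?B. seq_prob P xs) \<le> (\<Sum>xs\<in>?B. seq_prob P xs * (sum_list (map ?h xs))\<^sup>2)"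
    unfolding sum_distrib_left
  proof (rule sum_mono)
    fix xs assume xs: "xs \<in> ?B"
    have "(real n * \<delta>)\<^sup>2 \<le> (sum_list (map ?h xs))\<^sup>2"
      using xs \<open>0 < \<delta>\<close> by (intro power_mono) (auto simp: centred algebra_simps)
    then show "(real n * \<delta>)\<^sup>2 * seq_prob P xs \<le> seq_prob P xs * (sum_list (map ?h xs))\<^sup>2"
      using nonneg[of xs] by (metis mult.commute mult_left_mono)
  qed
  also have "\<dots> \<le> (\<Sum>xs\<in>words n. seq_prob P xs * (sum_list (map ?h xs))\<^sup>2)"
    by (rule sum_mono2) (auto simp: nonneg)
  also have "\<dots> = real n * (\<Sum>x\<in>UNIV. P x * (?h x)\<^sup>2)"
    by (rule variance_sum_list[OF P mean])
  finally show ?thesis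
    using assms(2,3) by (simp add: field_simps power2_eq_square)
qed

subsection \<open>Entropy and mutual information\<close>

text \<open>Average the inequality ln t \<le> t - 1 at t = r x / (p x * C) with weights
  \<open>p\<close>. The free mass bound \<open>C\<close> lets the comparison weights be a sum of one
  subprobability per message, so that log 2 \<open>C\<close> becomes the rate.\<close>

lemma gibbs_log:
  fixes p r :: "'c \<Rightarrow> real"
  assumes "finite A" and p: "\<And>x. x \<in> A \<Longrightarrow> 0 \<le> p x" "sum p A = 1"
    and r: "\<And>x. x \<in> A \<Longrightarrow> 0 \<le> r x" "\<And>x. x \<in> A \<Longrightarrow> 0 < p x \<Longrightarrow> 0 < r x" "sum r A \<le> C"
    and "0 < C"
  shows "(\<Sum>x\<in>A. p x * log 2 (r x / p x)) \<le> log 2 C"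
proof -
  have "p x * ln (r x / p x) - p x * ln C \<le> r x / C - p x" if "x \<in> A" for x
  proof (cases "p x = 0")
    case True
    then show ?thesis using r(1)[OF that] \<open>0 < C\<close> by simp
  next
    case False
    then have pos: "0 < p x" "0 < r x" using p(1)[OF that] r(2)[OF that] by auto
    have "ln (r x / p x / C) \<le> r x / p x / C - 1"
      using pos \<open>0 < C\<close> by (intro ln_le_minus_one) simp
    then have "p x * ln (r x / p x / C) \<le> p x * (r x / p x / C - 1)"
      using pos by (intro mult_left_mono) auto
    then show ?thesis using pos \<open>0 < C\<close> by (simp add: ln_div ln_mult algebra_simps)
  qed
  then have "(\<Sum>x\<in>A. p x * ln (r x / p x) - p x * ln C) \<le> (\<Sum>x\<in>A. r x / C - p x)"
    by (rule sum_mono)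
  also have "\<dots> = sum r A / C - 1"
    by (simp add: sum_subtractf p sum_divide_distrib)
  also have "\<dots> \<le> 0"
    using r(3) \<open>0 < C\<close> by simp
  finally have "(\<Sum>x\<in>A. p x * ln (r x / p x)) \<le> ln C"
    by (simp add: sum_subtractf p flip: sum_distrib_right)
  then show ?thesis
    by (simp add: log_def divide_right_mono flip: sum_divide_distrib)
qed

text \<open>The pointwise slacks \<open>d\<close> of ln t \<le> t - 1 are nonnegative and have total
  at most zero, so each vanishes, and ln t = t - 1 only at t = 1. Where \<open>p\<close> is zero the
  slack is \<open>r\<close> itself.\<close>

lemma gibbs_equality:
  fixes p r :: "'c \<Rightarrow> real"
  assumes "finite A" and p: "\<And>x. x \<in> A \<Longrightarrow> 0 \<le> p x" "sum p A = 1"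
    and r: "\<And>x. x \<in> A \<Longrightarrow> 0 \<le> r x" "\<And>x. x \<in> A \<Longrightarrow> 0 < p x \<Longrightarrow> 0 < r x" "sum r A \<le> 1"
    and eq: "(\<Sum>x\<in>A. p x * log 2 (r x / p x)) \<ge> 0" and "x \<in> A"
  shows "p x = r x"
proof -
  define d where "d x = r x - p x - p x * ln (r x / p x)" for x
  have d_nonneg: "0 \<le> d x" if "x \<in> A" for x
  proof (cases "p x = 0")
    case True
    then show ?thesis using r(1)[OF that] by (simp add: d_def)
  next
    case False
    then have pos: "0 < p x" "0 < r x" using p(1)[OF that] r(2)[OF that] by auto
    have "p x * ln (r x / p x) \<le> p x * (r x / p x - 1)"
      using pos by (intro mult_left_mono ln_le_minus_one) auto
    then show ?thesis using pos by (simp add: d_def algebra_simps)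
  qed
  have "(\<Sum>x\<in>A. p x * ln (r x / p x)) = ln 2 * (\<Sum>x\<in>A. p x * log 2 (r x / p x))"
    by (simp add: log_def sum_distrib_left)
  moreover have "0 \<le> ln 2 * (\<Sum>x\<in>A. p x * log 2 (r x / p x))"
    using eq by (intro mult_nonneg_nonneg) auto
  ultimately have "sum d A \<le> 0"
    using r(3) p(2) by (simp add: d_def sum_subtractf)
  then have "d x = 0"
    using d_nonneg \<open>finite A\<close> \<open>x \<in> A\<close> sum_nonneg[of A d] sum_nonneg_eq_0_iff[of A d] by force
  show ?thesis
  proof (cases "p x = 0")
    case True
    then show ?thesis using \<open>d x = 0\<close> by (simp add: d_def)
  next
    case False
    then have pos: "0 < p x" "0 < r x" using p(1)[OF \<open>x \<in> A\<close>] r(2)[OF \<open>x \<in> A\<close>] by auto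
    have "p x * ln (r x / p x) = p x * (r x / p x - 1)"
      using \<open>d x = 0\<close> pos by (simp add: d_def algebra_simps)
    then have "ln (r x / p x) = r x / p x - 1" using pos by simp
    then have "r x / p x = 1" using pos by (intro ln_eq_minus_one) auto
    then show ?thesis using pos by simp
  qed
qed

lemma out_dist_nonneg:
  assumes "\<And>x. 0 \<le> P x" "channel W"
  shows "0 \<le> out_dist P W y"
  using assms by (auto simp: out_dist_def channel_def intro!: sum_nonneg)

lemma le_out_dist:
  assumes "\<And>x. 0 \<le> P x" "channel W"
  shows "P x * W x y \<le> out_dist P W y"
  unfolding out_dist_def using assms
  by (intro member_le_sum) (auto simp: channel_def)

lemma out_dist_pos:
  assumes "\<And>x. 0 \<le> P x" "channel W" "0 < P x" "0 < W x y"
  shows "0 < out_dist P W y"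
proof -
  have "0 < P x * W x y" using assms by simp
  also have "\<dots> \<le> out_dist P W y" by (rule le_out_dist) (use assms in auto)
  finally show ?thesis .
qed

lemma sum_out_dist:
  fixes P :: "'a::finite \<Rightarrow> real" and W :: "'a \<Rightarrow> 'b::finite \<Rightarrow> real"
  assumes "channel W"
  shows "sum (out_dist P W) UNIV = sum P UNIV"
proof -
  have "sum (out_dist P W) UNIV = (\<Sum>x\<in>UNIV. \<Sum>y\<in>UNIV. P x * W x y)"
    unfolding out_dist_def by (rule sum.swap)
  also have "\<dots> = sum P UNIV"
    using assms by (simp add: channel_def flip: sum_distrib_left)
  finally show ?thesis .
qed

text \<open>This form serves the limit argument: it is built from terms t log t, continuous at t =
  0, whereas the quotient in \<open>mutual_info\<close> can degenerate to 0 / 0 in the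
  limit.\<close>

lemma mutual_info_eq_entropy_diff:
  fixes P :: "'a::finite \<Rightarrow> real" and W :: "'a \<Rightarrow> 'b::finite \<Rightarrow> real"
  assumes P: "\<And>x. 0 \<le> P x" and W: "channel W"
  shows "mutual_info P W = (\<Sum>x\<in>UNIV. \<Sum>y\<in>UNIV. P x * (W x y * log 2 (W x y)))
           - (\<Sum>y\<in>UNIV. out_dist P W y * log 2 (out_dist P W y))"
proof -
  have summand: "P x * W x y * log 2 (W x y / out_dist P W y)
      = P x * (W x y * log 2 (W x y)) - P x * W x y * log 2 (out_dist P W y)" for x y
  proof (cases "P x * W x y = 0")
    case False
    have "0 \<le> W x y" using W by (simp add: channel_def)
    then have "0 < W x y" "0 < P x * W x y" using False P[of x] by (auto simp: less_le)
    then have "0 < W x y" "0 < out_dist P W y"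
      using le_out_dist[of P W x y] P W by auto
    then show ?thesis by (simp add: log_divide algebra_simps)
  qed auto
  have "(\<Sum>x\<in>UNIV. \<Sum>y\<in>UNIV. P x * W x y * log 2 (out_dist P W y))
      = (\<Sum>y\<in>UNIV. \<Sum>x\<in>UNIV. P x * W x y * log 2 (out_dist P W y))"
    by (rule sum.swap)
  also have "\<dots> = (\<Sum>y\<in>UNIV. out_dist P W y * log 2 (out_dist P W y))"
    by (intro sum.cong refl) (simp add: out_dist_def sum_distrib_right)
  finally show ?thesis
    by (simp add: mutual_info_def summand sum_subtractf)
qed

definition source_entropy :: "('a::finite \<Rightarrow> real) \<Rightarrow> real" where
  "source_entropy P = - (\<Sum>x\<in>UNIV. P x * log 2 (P x))"

lemma cond_entropy_eq:
  fixes P :: "'a::finite \<Rightarrow> real" and W :: "'a \<Rightarrow> 'b::finite \<Rightarrow> real"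
  assumes P: "\<And>x. 0 \<le> P x" and W: "channel W"
  shows "cond_entropy P W = source_entropy P - mutual_info P W"
proof -
  have summand: "P x * W x y * log 2 (out_dist P W y / (P x * W x y))
      = - (P x * log 2 (P x)) * W x y - P x * W x y * log 2 (W x y / out_dist P W y)" for x y
  proof (cases "P x * W x y = 0")
    case False
    have "0 \<le> W x y" using W by (simp add: channel_def)
    then have "0 < W x y" "0 < P x" "0 < P x * W x y" using False P[of x] by (auto simp: less_le)
    moreover then have "0 < out_dist P W y"
      using P W by (intro out_dist_pos[of P W x y]) auto
    ultimately show ?thesis by (simp add: log_divide log_mult algebra_simps)
  qed auto
  have "(\<Sum>x\<in>UNIV. \<Sum>y\<in>UNIV. - (P x * log 2 (P x)) * W x y) = source_entropy P"
    using W by (simp add: channel_def source_entropy_def sum_negf flip: sum_distrib_left)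
  then show ?thesis
    by (simp only: cond_entropy_def summand sum_subtractf mutual_info_def)
qed

text \<open>Gibbs' inequality for the joint law against the product of its marginals. It also bounds
  the set under \<open>Inf\<close> in \<open>RDE\<close> from below.\<close>

lemma mutual_info_nonneg:
  fixes P :: "'a::finite \<Rightarrow> real" and W :: "'a \<Rightarrow> 'b::finite \<Rightarrow> real"
  assumes P: "pmf_on P" and W: "channel W"
  shows "0 \<le> mutual_info P W"
proof -
  have P0: "0 \<le> P x" for x using P by (simp add: pmf_on_def)
  have W0: "0 \<le> W x y" for x y using W by (simp add: channel_def)
  define p where "p z = P (fst z) * W (fst z) (snd z)" for z
  define r where "r z = P (fst z) * out_dist P W (snd z)" for z
  have pos: "0 < P x \<and> 0 < W x y \<and> 0 < out_dist P W y" if "0 < P x * W x y" for x y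
  proof -
    have "0 < P x" "0 < W x y"
      using that P0[of x] W0[of x y] by (auto simp: zero_less_mult_iff)
    then show ?thesis using P0 W by (auto intro: out_dist_pos[of P W x y])
  qed
  have "(\<Sum>z\<in>UNIV. p z * log 2 (r z / p z)) \<le> log 2 1"
  proof (rule gibbs_log)
    show "0 \<le> p z" "0 \<le> r z" for z
      using P0 W0 W out_dist_nonneg[of P W] by (auto simp: p_def r_def)
    show "sum p UNIV = 1"
      using P W by (simp add: p_def sum_UNIV_prod channel_def pmf_on_def flip: sum_distrib_left)
    show "sum r UNIV \<le> 1"
      using P sum_out_dist[OF W, of P]
      by (simp add: r_def sum_UNIV_prod pmf_on_def flip: sum_distrib_left)
    show "0 < r z" if "0 < p z" for z
      using pos[of "fst z" "snd z"] that by (simp add: p_def r_def)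
  qed auto
  moreover have "p z * log 2 (r z / p z)
      = - (P (fst z) * W (fst z) (snd z) * log 2 (W (fst z) (snd z) / out_dist P W (snd z)))" for z
  proof (cases "p z = 0")
    case False
    have "0 < p z" using False P0[of "fst z"] W0[of "fst z" "snd z"] by (simp add: p_def less_le)
    then have "0 < P (fst z) \<and> 0 < W (fst z) (snd z) \<and> 0 < out_dist P W (snd z)"
      using pos[of "fst z" "snd z"] by (simp add: p_def)
    then show ?thesis by (simp add: p_def r_def log_divide log_mult algebra_simps)
  qed (auto simp: p_def)
  ultimately have "(\<Sum>z\<in>UNIV. - (P (fst z) * W (fst z) (snd z)
      * log 2 (W (fst z) (snd z) / out_dist P W (snd z)))) \<le> 0"
    by simp
  then show ?thesis by (simp add: sum_negf sum_UNIV_prod mutual_info_def)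
qed

section \<open>The rate-distortion-equivocation function\<close>

lemma RDE_le_mutual_info:
  assumes P: "pmf_on P" and "channel W" "exp_dist P W g \<le> D" "E \<le> cond_entropy P W"
  shows "RDE P g D E \<le> mutual_info P W"
  unfolding RDE_def
proof (rule cInf_lower)
  show "bdd_below {mutual_info P W |W. channel W \<and> exp_dist P W g \<le> D \<and> E \<le> cond_entropy P W}"
    using mutual_info_nonneg[OF P] by (intro bdd_belowI[of _ 0]) auto
qed (use assms in auto)

lemma RDE_greatest:
  assumes "rde_feasible P g D E"
    and "\<And>W. channel W \<Longrightarrow> exp_dist P W g \<le> D \<Longrightarrow> E \<le> cond_entropy P W \<Longrightarrow> c \<le> mutual_info P W"
  shows "c \<le> RDE P g D E"
  unfolding RDE_def using assms by (intro cInf_greatest) (auto simp: rde_feasible_def)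

lemma RDE_le_entropy_diff:
  assumes P: "pmf_on P" and feas: "rde_feasible P g D E"
  shows "RDE P g D E \<le> source_entropy P - E"
proof -
  obtain W where W: "channel W" "exp_dist P W g \<le> D" "E \<le> cond_entropy P W"
    using feas by (auto simp: rde_feasible_def)
  have "mutual_info P W \<le> source_entropy P - E"
    using cond_entropy_eq[of P W] W P by (simp add: pmf_on_def)
  then show ?thesis using RDE_le_mutual_info[OF P W] by simp
qed

text \<open>A rate of at most R(D,E) \<le> H(X) - E forces equivocation at least E, so
  \<open>W\<close> is itself a competitor in the infimum. In the converse this turns an upper bound
  on the rate of a limit channel into attainment.\<close>

lemma RDE_eq_mutual_infoI:
  assumes P: "pmf_on P" and feas: "rde_feasible P g D E"
    and W: "channel W" "exp_dist P W g \<le> D" "mutual_info P W \<le> RDE P g D E"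
  shows "RDE P g D E = mutual_info P W"
proof (rule antisym)
  have "E \<le> cond_entropy P W"
    using RDE_le_entropy_diff[OF P feas] W cond_entropy_eq[of P W] P by (simp add: pmf_on_def)
  then show "RDE P g D E \<le> mutual_info P W"
    by (rule RDE_le_mutual_info[OF P W(1,2)])
qed (rule W)

lemma RDE_nonneg:
  assumes "pmf_on P" "rde_feasible P g D E"
  shows "0 \<le> RDE P g D E"
  using assms mutual_info_nonneg by (intro RDE_greatest) auto

text \<open>A channel for the second pair whose rate lay below R(D1,E1) \<le> H(X) - E1 would have
  equivocation above E1 and so compete in the first infimum, a contradiction. The lemma makes the
  rate increment of the second stage nonnegative.\<close>

lemma RDE_mono:
  assumes P: "pmf_on P" and feas: "rde_feasible P g D1 E1" "rde_feasible P g D2 E2" and "D2 \<le> D1"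
  shows "RDE P g D1 E1 \<le> RDE P g D2 E2"
proof (rule RDE_greatest[OF feas(2)])
  fix W assume W: "channel W" "exp_dist P W g \<le> D2" "E2 \<le> cond_entropy P W"
  show "RDE P g D1 E1 \<le> mutual_info P W"
  proof (rule ccontr)
    assume "\<not> ?thesis"
    then have "E1 \<le> cond_entropy P W"
      using RDE_le_entropy_diff[OF P feas(1)] cond_entropy_eq[of P W] W P by (simp add: pmf_on_def)
    then have "RDE P g D1 E1 \<le> mutual_info P W"
      using W \<open>D2 \<le> D1\<close> by (intro RDE_le_mutual_info P) auto
    with \<open>\<not> ?thesis\<close> show False by simp
  qed
qed

section \<open>Pairs of reproductions, data processing and the Markov condition\<close>

text \<open>Reading the two reproductions as one letter of a product alphabet makes I(X;Y1,Y2) an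
  instance of \<open>mutual_info\<close>, with all channel lemmas available.\<close>

definition pair_channel :: "('a \<Rightarrow> 'b \<Rightarrow> 'b \<Rightarrow> real) \<Rightarrow> 'a \<Rightarrow> 'b \<times> 'b \<Rightarrow> real" where
  "pair_channel Q x z = Q x (fst z) (snd z)"

lemma channel_pair_iff: "channel (pair_channel Q) \<longleftrightarrow> cond_pmf2 Q"
  by (simp add: channel_def cond_pmf2_def pair_channel_def sum_UNIV_prod)

lemma channel_marg1: "cond_pmf2 Q \<Longrightarrow> channel (marg1 Q)"
  by (auto simp: channel_def cond_pmf2_def marg1_def intro!: sum_nonneg)

lemma channel_marg2:
  assumes "cond_pmf2 Q" shows "channel (marg2 Q)"
proof -
  have "sum (marg2 Q x) UNIV = (\<Sum>y1\<in>UNIV. \<Sum>y2\<in>UNIV. Q x y1 y2)" for x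
    unfolding marg2_def by (rule sum.swap)
  then show ?thesis
    using assms by (auto simp: channel_def cond_pmf2_def marg2_def intro!: sum_nonneg)
qed

lemma sum_marg1:
  "(\<Sum>x\<in>UNIV. \<Sum>y\<in>UNIV. P x * marg1 Q x y * F x y)
    = (\<Sum>x\<in>UNIV. \<Sum>y1\<in>UNIV. \<Sum>y2\<in>UNIV. P x * Q x y1 y2 * F x y1)"
  by (simp add: marg1_def sum_distrib_left sum_distrib_right)

lemma sum_marg2:
  "(\<Sum>x\<in>UNIV. \<Sum>y\<in>UNIV. P x * marg2 Q x y * F x y)
    = (\<Sum>x\<in>UNIV. \<Sum>y1\<in>UNIV. \<Sum>y2\<in>UNIV. P x * Q x y1 y2 * F x y2)"
  unfolding marg2_def sum_distrib_left sum_distrib_right by (rule sum.cong[OF refl]) (rule sum.swap)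

lemma mutual_info_pair:
  "mutual_info P (pair_channel Q) = (\<Sum>x\<in>UNIV. \<Sum>y1\<in>UNIV. \<Sum>y2\<in>UNIV.
      P x * Q x y1 y2 * log 2 (Q x y1 y2 / out_dist P (pair_channel Q) (y1, y2)))"
  by (simp add: mutual_info_def sum_UNIV_prod pair_channel_def)

lemma markov_iff:
  "markov_X_Y2_Y1 P Q \<longleftrightarrow> (\<forall>x y1 y2. P x * Q x y1 y2 * out_dist P (marg2 Q) y2
      = P x * marg2 Q x y2 * out_dist P (pair_channel Q) (y1, y2))"
  by (simp add: markov_X_Y2_Y1_def out_dist_def marg2_def pair_channel_def sum_distrib_left)

text \<open>Collects, for one point of the support, the positivity of every logarithm argument and
  denominator that occurs in the identities below.\<close>

lemma pair_channel_positivity: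
  assumes "pmf_on P" and Q: "cond_pmf2 Q" and "0 < P x * Q x y1 y2"
  shows "0 < P x" "0 < Q x y1 y2" "0 < marg1 Q x y1" "0 < marg2 Q x y2"
    "0 < out_dist P (pair_channel Q) (y1, y2)" "0 < out_dist P (marg1 Q) y1" "0 < out_dist P (marg2 Q) y2"
proof -
  have P: "0 \<le> P x" for x using assms(1) by (simp add: pmf_on_def)
  have Q0: "0 \<le> Q x y1 y2" for x y1 y2 using Q by (simp add: cond_pmf2_def)
  show Px: "0 < P x" and Qx: "0 < Q x y1 y2"
    using assms(3) P[of x] Q0[of x y1 y2] by (auto simp: zero_less_mult_iff)
  show m1: "0 < marg1 Q x y1"
    unfolding marg1_def using Qx Q0 by (intro sum_pos2[of _ y2]) auto
  show m2: "0 < marg2 Q x y2"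
    unfolding marg2_def using Qx Q0 by (intro sum_pos2[of _ y1]) auto
  show "0 < out_dist P (pair_channel Q) (y1, y2)"
    using P Q Px Qx by (intro out_dist_pos[of P _ x]) (auto simp: channel_pair_iff pair_channel_def)
  show "0 < out_dist P (marg1 Q) y1"
    using P Q Px m1 by (intro out_dist_pos[of P _ x]) (auto simp: channel_marg1)
  show "0 < out_dist P (marg2 Q) y2"
    using P Q Px m2 by (intro out_dist_pos[of P _ x]) (auto simp: channel_marg2)
qed

text \<open>The Markov identity makes the two information densities equal at each point of the
  support, hence also on average.\<close>

lemma mutual_info_pair_markov:
  fixes P :: "'a::finite \<Rightarrow> real" and Q :: "'a \<Rightarrow> 'b::finite \<Rightarrow> 'b \<Rightarrow> real"
  assumes P: "pmf_on P" and Q: "cond_pmf2 Q" and markov: "markov_X_Y2_Y1 P Q"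
  shows "mutual_info P (pair_channel Q) = mutual_info P (marg2 Q)"
proof -
  have P0: "0 \<le> P x" for x using P by (simp add: pmf_on_def)
  have summand: "P x * Q x y1 y2 * log 2 (Q x y1 y2 / out_dist P (pair_channel Q) (y1, y2))
      = P x * Q x y1 y2 * log 2 (marg2 Q x y2 / out_dist P (marg2 Q) y2)" for x y1 y2
  proof (cases "P x * Q x y1 y2 = 0")
    case False
    then have J: "0 < P x * Q x y1 y2" using P0[of x] Q by (simp add: cond_pmf2_def less_le)
    have "P x * (Q x y1 y2 * out_dist P (marg2 Q) y2) = P x * (marg2 Q x y2 * out_dist P (pair_channel Q) (y1, y2))"
      using markov unfolding markov_iff mult.assoc by blast
    then have "Q x y1 y2 / out_dist P (pair_channel Q) (y1, y2) = marg2 Q x y2 / out_dist P (marg2 Q) y2"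
      using pair_channel_positivity[OF P Q J] by (simp add: frac_eq_eq)
    then show ?thesis by simp
  qed auto
  show ?thesis
    unfolding mutual_info_pair summand by (simp add: mutual_info_def sum_marg2)
qed

text \<open>The difference I(X;Y2) - I(X;Y1,Y2) is minus the divergence of the joint law
  \<open>p\<close> from the law \<open>r\<close> under which X and Y1 are independent given Y2.
  Gibbs' inequality gives the first claim and its equality case \<open>p\<close> = \<open>r\<close>,
  which is the Markov condition, gives the second.\<close>

lemma
  fixes P :: "'a::finite \<Rightarrow> real" and Q :: "'a \<Rightarrow> 'b::finite \<Rightarrow> 'b \<Rightarrow> real"
  assumes P: "pmf_on P" and Q: "cond_pmf2 Q"
  shows mutual_info_marg2_le: "mutual_info P (marg2 Q) \<le> mutual_info P (pair_channel Q)"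
    and markov_if_mutual_info_le:
      "mutual_info P (pair_channel Q) \<le> mutual_info P (marg2 Q) \<Longrightarrow> markov_X_Y2_Y1 P Q"
proof -
  have P0: "0 \<le> P x" for x using P by (simp add: pmf_on_def)
  have Q0: "0 \<le> Q x y1 y2" for x y1 y2 using Q by (simp add: cond_pmf2_def)
  let ?o2 = "out_dist P (marg2 Q)" and ?o12 = "out_dist P (pair_channel Q)"
  have o0: "0 \<le> ?o2 y" "0 \<le> ?o12 z" for y z
    using out_dist_nonneg[of P] P0 Q channel_marg2 channel_pair_iff by blast+
  have m0: "0 \<le> marg2 Q x y" for x y
    using Q0 by (auto simp: marg2_def intro: sum_nonneg)
  define p where "p = (\<lambda>(x, y1, y2). P x * Q x y1 y2)"
  define r where "r = (\<lambda>(x, y1, y2). P x * marg2 Q x y2 * ?o12 (y1, y2) / ?o2 y2)"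
  have p0: "0 \<le> p z" and r0: "0 \<le> r z" for z
    using P0 Q0 m0 o0 by (auto simp: p_def r_def split: prod.split)
  have r_pos: "0 < r z" if "0 < p z" for z
  proof -
    obtain x y1 y2 where z: "z = (x, y1, y2)" by (cases z)
    then have J: "0 < P x * Q x y1 y2" using that by (simp add: p_def)
    show ?thesis using pair_channel_positivity[OF P Q J] by (simp add: r_def z)
  qed
  have p_sum: "sum p UNIV = 1"
    using P Q by (simp add: p_def sum_UNIV_prod cond_pmf2_def pmf_on_def flip: sum_distrib_left)
  have o2_eq: "?o2 y2 = (\<Sum>y1\<in>UNIV. ?o12 (y1, y2))" for y2
    unfolding out_dist_def marg2_def pair_channel_def sum_distrib_left by (simp, rule sum.swap)
  have "sum r UNIV = (\<Sum>x\<in>UNIV. \<Sum>y1\<in>UNIV. \<Sum>y2\<in>UNIV. P x * marg2 Q x y2 * ?o12 (y1, y2) / ?o2 y2)"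
    by (simp add: r_def sum_UNIV_prod)
  also have "\<dots> = (\<Sum>x\<in>UNIV. \<Sum>y2\<in>UNIV. \<Sum>y1\<in>UNIV. P x * marg2 Q x y2 * ?o12 (y1, y2) / ?o2 y2)"
    by (rule sum.cong[OF refl]) (rule sum.swap)
  \<comment> \<open>The quotient is 1, or 0 at letters \<open>y2\<close> of output probability zero;
    hence \<open>r\<close> is only bounded by mass one.\<close>
  also have "\<dots> = (\<Sum>x\<in>UNIV. \<Sum>y2\<in>UNIV. P x * marg2 Q x y2 * (?o2 y2 / ?o2 y2))"
    by (simp only: o2_eq times_divide_eq_right sum_distrib_left[symmetric] sum_divide_distrib[symmetric])
  also have "\<dots> \<le> (\<Sum>x\<in>UNIV. \<Sum>y2\<in>UNIV. P x * marg2 Q x y2)"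
    using P0 m0 by (intro sum_mono) auto
  also have "\<dots> = 1"
    using P channel_marg2[OF Q] by (simp add: channel_def pmf_on_def flip: sum_distrib_left)
  finally have r_sum: "sum r UNIV \<le> 1" .
  have summand: "p (x, y1, y2) * log 2 (r (x, y1, y2) / p (x, y1, y2))
      = P x * Q x y1 y2 * log 2 (marg2 Q x y2 / ?o2 y2)
        - P x * Q x y1 y2 * log 2 (Q x y1 y2 / ?o12 (y1, y2))" for x y1 y2
  proof (cases "P x * Q x y1 y2 = 0")
    case False
    then have J: "0 < P x * Q x y1 y2" using P0[of x] Q0[of x y1 y2] by (simp add: less_le)
    show ?thesis
      using pair_channel_positivity[OF P Q J]
      by (simp add: p_def r_def log_divide log_mult algebra_simps)
  qed (auto simp: p_def)
  have diff: "(\<Sum>z\<in>UNIV. p z * log 2 (r z / p z)) = mutual_info P (marg2 Q) - mutual_info P (pair_channel Q)"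
    unfolding sum_UNIV_prod summand sum_subtractf mutual_info_pair by (simp add: mutual_info_def sum_marg2)
  have "(\<Sum>z\<in>UNIV. p z * log 2 (r z / p z)) \<le> log 2 1"
    using p0 r0 r_pos p_sum r_sum by (intro gibbs_log) auto
  then show "mutual_info P (marg2 Q) \<le> mutual_info P (pair_channel Q)"
    by (simp add: diff)
  assume "mutual_info P (pair_channel Q) \<le> mutual_info P (marg2 Q)"
  then have "p z = r z" for z
    using p0 r0 r_pos p_sum r_sum diff by (intro gibbs_equality[of UNIV p r]) auto
  from this[of "(x, y1, y2)" for x y1 y2] have eq: "P x * Q x y1 y2 = P x * marg2 Q x y2 * ?o12 (y1, y2) / ?o2 y2" for x y1 y2
    by (simp add: p_def r_def)
  \<comment> \<open>Back to the cross-multiplied form. If the output probability of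
    \<open>y2\<close> is zero, then P x * marg2 Q x y2, which it dominates, is zero too and both
    sides vanish.\<close>
  have "P x * Q x y1 y2 * ?o2 y2 = P x * marg2 Q x y2 * ?o12 (y1, y2)" for x y1 y2
  proof (cases "?o2 y2 = 0")
    case True
    have "P x * marg2 Q x y2 \<le> 0"
      using le_out_dist[of P "marg2 Q" x y2] P0 channel_marg2[OF Q] True by simp
    then have "P x * marg2 Q x y2 = 0" using mult_nonneg_nonneg[OF P0[of x] m0[of x y2]] by linarith
    then show ?thesis using True by simp
  next
    case False
    then show ?thesis using eq[of x y1 y2] by simp
  qed
  then show "markov_X_Y2_Y1 P Q" by (simp add: markov_iff)
qed

subsection \<open>Converse\<close>

text \<open>The joint law of source letter and reproduction letter at a uniformly chosen position.
  The alphabet \<open>'c\<close> is left open so that it can also be a pair of reproduction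
  letters.\<close>

definition avg_joint :: "('a \<Rightarrow> real) \<Rightarrow> nat \<Rightarrow> ('a list \<Rightarrow> 'c list) \<Rightarrow> 'a \<Rightarrow> 'c \<Rightarrow> real" where
  "avg_joint P n u x y =
     (\<Sum>xs\<in>words n. seq_prob P xs * (\<Sum>i<n. of_bool (xs ! i = x \<and> u xs ! i = y))) / real n"

lemma avg_joint_nonneg:
  assumes "\<And>x. 0 \<le> P x"
  shows "0 \<le> avg_joint P n u x y"
  unfolding avg_joint_def using assms
  by (intro divide_nonneg_nonneg sum_nonneg mult_nonneg_nonneg seq_prob_nonneg) auto

text \<open>The expectation of a letter function under the averaged law is the expected position
  average in the block. The choices of \<open>F\<close> made later are an indicator (source
  marginal), the distortion, and the information density.\<close>

lemma sum_avg_joint: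
  fixes P :: "'a::finite \<Rightarrow> real" and u :: "'a list \<Rightarrow> 'c::finite list"
  shows "(\<Sum>x\<in>UNIV. \<Sum>y\<in>UNIV. avg_joint P n u x y * F x y)
    = (\<Sum>xs\<in>words n. seq_prob P xs * (\<Sum>i<n. F (xs ! i) (u xs ! i))) / real n"
proof -
  have one: "(\<Sum>z\<in>UNIV. of_bool (a = fst z \<and> b = snd z) * F (fst z) (snd z)) = F a b" for a b
  proof -
    have "(\<Sum>z\<in>UNIV. of_bool (a = fst z \<and> b = snd z) * F (fst z) (snd z))
       = (\<Sum>z\<in>UNIV. if z = (a, b) then F a b else 0)"
      by (intro sum.cong) auto
    then show ?thesis by simp
  qed
  have "(\<Sum>x\<in>UNIV. \<Sum>y\<in>UNIV. avg_joint P n u x y * F x y)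
     = (\<Sum>z\<in>UNIV. avg_joint P n u (fst z) (snd z) * F (fst z) (snd z))"
    by (simp add: sum_UNIV_prod)
  also have "\<dots> = (\<Sum>z\<in>UNIV. \<Sum>xs\<in>words n. \<Sum>i<n. seq_prob P xs *
      (of_bool (xs ! i = fst z \<and> u xs ! i = snd z) * F (fst z) (snd z))) / real n"
    by (simp only: avg_joint_def sum_distrib_left sum_distrib_right sum_divide_distrib times_divide_eq_left
        mult.assoc)
  also have "(\<Sum>z\<in>UNIV. \<Sum>xs\<in>words n. \<Sum>i<n. seq_prob P xs *
      (of_bool (xs ! i = fst z \<and> u xs ! i = snd z) * F (fst z) (snd z)))
     = (\<Sum>xs\<in>words n. \<Sum>z\<in>UNIV. \<Sum>i<n. seq_prob P xs *
      (of_bool (xs ! i = fst z \<and> u xs ! i = snd z) * F (fst z) (snd z)))"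
    by (rule sum.swap)
  also have "\<dots> = (\<Sum>xs\<in>words n. \<Sum>i<n. \<Sum>z\<in>UNIV. seq_prob P xs *
      (of_bool (xs ! i = fst z \<and> u xs ! i = snd z) * F (fst z) (snd z)))"
    by (intro sum.cong refl) (rule sum.swap)
  also have "\<dots> = (\<Sum>xs\<in>words n. seq_prob P xs * (\<Sum>i<n. F (xs ! i) (u xs ! i)))"
    by (simp only: one sum_distrib_left[symmetric])
  finally show ?thesis .
qed

lemma sum_list_map_nth: "sum_list (map f xs) = (\<Sum>i<length xs. f (xs ! i))"
  for f :: "'a \<Rightarrow> real"
  by (simp add: sum_list_sum_nth atLeast0LessThan)

lemma avg_joint_marginal:
  fixes P :: "'a::finite \<Rightarrow> real" and u :: "'a list \<Rightarrow> 'c::finite list"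
  assumes "pmf_on P" "0 < n"
  shows "(\<Sum>y\<in>UNIV. avg_joint P n u x y) = P x"
proof -
  have "(\<Sum>y\<in>UNIV. avg_joint P n u x y)
      = (\<Sum>x'\<in>UNIV. \<Sum>y\<in>UNIV. avg_joint P n u x' y * of_bool (x' = x))"
  proof -
    have "(\<Sum>y\<in>UNIV. avg_joint P n u x' y * of_bool (x' = x))
       = (if x' = x then \<Sum>y\<in>UNIV. avg_joint P n u x y else 0)" for x'
      by simp
    then show ?thesis by simp
  qed
  also have "\<dots> = (\<Sum>xs\<in>words n. seq_prob P xs * (\<Sum>i<n. of_bool (xs ! i = x))) / real n"
    by (rule sum_avg_joint)
  also have "\<dots> = (\<Sum>xs\<in>words n. seq_prob P xs * sum_list (map (\<lambda>a. of_bool (a = x)) xs)) / real n"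
    by (simp add: sum_list_map_nth)
  also have "\<dots> = (\<Sum>a\<in>UNIV. P a * of_bool (a = x))"
    using expectation_sum_list[OF assms(1), where n = n and f = "\<lambda>a. of_bool (a = x)"] \<open>0 < n\<close> by simp
  also have "\<dots> = P x"
    by (simp add: of_bool_def if_distrib cong: if_cong)
  finally show ?thesis .
qed

text \<open>The conditional law belonging to \<open>avg_joint\<close>. Rows of source letters with
  probability zero are undetermined; the uniform row keeps the result a channel.\<close>

definition avg_channel :: "('a \<Rightarrow> real) \<Rightarrow> nat \<Rightarrow> ('a list \<Rightarrow> 'c::finite list) \<Rightarrow> 'a \<Rightarrow> 'c \<Rightarrow> real" where
  "avg_channel P n u x y =
     (if P x = 0 then 1 / real CARD('c) else avg_joint P n u x y / P x)"

lemma channel_avg_channel: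
  fixes P :: "'a::finite \<Rightarrow> real" and u :: "'a list \<Rightarrow> 'c::finite list"
  assumes "pmf_on P" "0 < n"
  shows "channel (avg_channel P n u)"
proof -
  have P: "0 \<le> P x" for x using assms by (simp add: pmf_on_def)
  have "sum (avg_channel P n u x) UNIV = 1" for x
    using avg_joint_marginal[OF assms, of u x]
    by (cases "P x = 0") (simp_all add: avg_channel_def flip: sum_divide_distrib)
  then show ?thesis
    using P avg_joint_nonneg[of P n u] by (simp add: channel_def avg_channel_def)
qed

lemma avg_channel_joint:
  fixes P :: "'a::finite \<Rightarrow> real" and u :: "'a list \<Rightarrow> 'c::finite list"
  assumes "pmf_on P" "0 < n"
  shows "P x * avg_channel P n u x y = avg_joint P n u x y"
proof (cases "P x = 0")
  case True
  have "avg_joint P n u x y \<le> (\<Sum>y\<in>UNIV. avg_joint P n u x y)"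
    using assms by (intro member_le_sum avg_joint_nonneg) (auto simp: pmf_on_def)
  then have "avg_joint P n u x y \<le> 0"
    using avg_joint_marginal[OF assms, of u x] True by simp
  moreover have "0 \<le> avg_joint P n u x y"
    using assms by (intro avg_joint_nonneg) (auto simp: pmf_on_def)
  ultimately show ?thesis using True by simp
qed (simp add: avg_channel_def)

lemma exp_dist_avg_joint:
  fixes P :: "'a::finite \<Rightarrow> real" and g :: "'a \<Rightarrow> 'c::finite \<Rightarrow> real"
  assumes "\<And>x y. P x * W x y = avg_joint P n u x y"
  shows "exp_dist P W g = block_dist P g n u"
  by (simp add: exp_dist_def assms sum_avg_joint block_dist_def)
    (simp add: sum_divide_distrib[of _ "words n"])

text \<open>The codeword \<open>\<psi> m\<close> is compared with the product of the backward channel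
  \<open>P x W(y|x) / out_dist P W y\<close>: for each message its mass is at most one, so the total mass is at
  most the number of messages, and Gibbs' inequality gives the single-letter bound directly.\<close>

lemma rate_ge_mutual_info:
  fixes P :: "'a::finite \<Rightarrow> real" and W :: "'a \<Rightarrow> 'c::finite \<Rightarrow> real"
    and h :: "'a list \<Rightarrow> 'm" and \<psi> :: "'m \<Rightarrow> 'c list"
  assumes P: "pmf_on P" and W: "channel W" and "0 < n"
    and joint: "\<And>x y. P x * W x y = avg_joint P n (\<lambda>xs. \<psi> (h xs)) x y"
    and len: "\<And>m. length (\<psi> m) = n"
    and M: "card (h ` words n) \<le> M"
  shows "real n * mutual_info P W \<le> log 2 (real M)"
proof -
  let ?u = "\<lambda>xs. \<psi> (h xs)"
  \<comment> \<open>The backward letter channel p(x|y). The output letter comes first in the pair so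
    that, with the codeword fixed, \<open>sum_seq_prob_zip\<close> sums over the source
    words.\<close>
  define T where "T = (\<lambda>(y, x). P x * W x y / out_dist P W y)"
  define r where "r xs = seq_prob T (zip (?u xs) xs)" for xs
  define I where "I x y = log 2 (W x y / out_dist P W y)" for x y
  have P0: "0 \<le> P x" for x using P by (simp add: pmf_on_def)
  have W0: "0 \<le> W x y" for x y using W by (simp add: channel_def)
  have T0: "0 \<le> T z" for z
    unfolding T_def using P0 W0 out_dist_nonneg[of P W] W by (auto split: prod.split)
  have nonneg: "0 \<le> seq_prob P xs" for xs by (rule seq_prob_nonneg) (rule P0)
  have pos: "0 < P (xs ! i)" "0 < W (xs ! i) (?u xs ! i)" "0 < out_dist P W (?u xs ! i)"
    if "length xs = n" "0 < seq_prob P xs" "i < n" for xs i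
  proof -
    let ?x = "xs ! i" and ?y = "?u xs ! i"
    show "0 < P ?x"
      using that seq_prob_pos_iff[of P xs] P0 by simp
    \<comment> \<open>A word of positive probability contributes its own letter pair to
      \<open>avg_joint\<close>, so that pair has positive joint mass.\<close>
    have "0 < seq_prob P xs * (\<Sum>j<n. of_bool (xs ! j = ?x \<and> ?u xs ! j = ?y))"
      using that by (intro mult_pos_pos sum_pos2[of _ i]) auto
    also have "\<dots> \<le> (\<Sum>xs\<in>words n. seq_prob P xs * (\<Sum>j<n. of_bool (xs ! j = ?x \<and> ?u xs ! j = ?y)))"
      using that nonneg by (intro member_le_sum[of xs]) (auto intro!: mult_nonneg_nonneg sum_nonneg)
    finally have "0 < P ?x * W ?x ?y"
      using \<open>0 < n\<close> by (simp add: joint avg_joint_def)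
    then have "0 < P ?x" "0 < W ?x ?y"
      using P0[of ?x] W0[of ?x ?y] by (auto simp: zero_less_mult_iff)
    then show "0 < W ?x ?y" "0 < out_dist P W ?y"
      using P0 W by (auto intro: out_dist_pos[of P W ?x ?y])
  qed
  have r_pos: "0 < r xs" and log_r: "log 2 (r xs / seq_prob P xs) = (\<Sum>i<n. I (xs ! i) (?u xs ! i))"
    if xs: "length xs = n" "0 < seq_prob P xs" for xs
  proof -
    have T_pos: "0 < T z" if "z \<in> set (zip (?u xs) xs)" for z
      using that pos[OF xs] by (auto simp: set_zip T_def xs len)
    show "0 < r xs" unfolding r_def by (rule seq_prob_pos) (rule T_pos)
    have "log 2 (r xs) = (\<Sum>i<n. log 2 (T (?u xs ! i, xs ! i)))"
      unfolding r_def using T_pos by (simp add: log_seq_prob sum_list_map_nth len xs)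
    moreover have "log 2 (seq_prob P xs) = (\<Sum>i<n. log 2 (P (xs ! i)))"
      using pos[OF xs] xs(1) by (subst log_seq_prob) (auto simp: sum_list_map_nth in_set_conv_nth)
    moreover have "log 2 (T (?u xs ! i, xs ! i)) - log 2 (P (xs ! i)) = I (xs ! i) (?u xs ! i)"
      if "i < n" for i
      using pos[OF xs that] by (simp add: T_def I_def log_divide log_mult)
    ultimately show "log 2 (r xs / seq_prob P xs) = (\<Sum>i<n. I (xs ! i) (?u xs ! i))"
      using \<open>0 < r xs\<close> xs by (simp add: log_divide flip: sum_subtractf)
  qed
  have code_mass: "(\<Sum>xs\<in>words n. seq_prob T (zip (\<psi> m) xs)) \<le> 1" for m
  proof -
    have "(\<Sum>xs\<in>words n. seq_prob T (zip (\<psi> m) xs)) = seq_prob (\<lambda>y. \<Sum>x\<in>UNIV. T (y, x)) (\<psi> m)"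
      using sum_seq_prob_zip[of T "\<psi> m"] by (simp add: len)
    also have "\<dots> \<le> 1"
    proof (rule seq_prob_le_one)
      show "0 \<le> (\<Sum>x\<in>UNIV. T (y, x))" for y
        by (intro sum_nonneg T0)
      have "(\<Sum>x\<in>UNIV. T (y, x)) = (\<Sum>x\<in>UNIV. P x * W x y) / out_dist P W y" for y
        by (simp add: T_def sum_divide_distrib)
      then have "(\<Sum>x\<in>UNIV. T (y, x)) = out_dist P W y / out_dist P W y" for y
        by (simp only: out_dist_def)
      then show "(\<Sum>x\<in>UNIV. T (y, x)) \<le> 1" for y by simp
    qed
    finally show ?thesis .
  qed
  have "words n \<noteq> ({} :: 'a list set)"
    by (auto intro: exI[of _ "replicate n undefined"])
  then have "0 < card (h ` words n)" by (simp add: card_gt_0_iff)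
  have "(\<Sum>xs\<in>words n. r xs) = (\<Sum>m\<in>h ` words n. \<Sum>xs\<in>{xs \<in> words n. h xs = m}. r xs)"
    by (rule sum.image_gen) simp
  \<comment> \<open>On the fibre of a message the codeword is constant, so the fibre sum may be
    enlarged to all source words under one product of backward letters.\<close>
  also have "\<dots> = (\<Sum>m\<in>h ` words n. \<Sum>xs\<in>{xs \<in> words n. h xs = m}. seq_prob T (zip (\<psi> m) xs))"
    by (intro sum.cong) (auto simp: r_def)
  also have "\<dots> \<le> (\<Sum>m\<in>h ` words n. \<Sum>xs\<in>words n. seq_prob T (zip (\<psi> m) xs))"
    by (intro sum_mono sum_mono2) (auto intro!: seq_prob_nonneg T0)
  also have "\<dots> \<le> (\<Sum>m\<in>h ` words n. 1)"
    by (intro sum_mono code_mass)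
  also have "\<dots> \<le> real M" using M by simp
  finally have r_sum: "(\<Sum>xs\<in>words n. r xs) \<le> real M" .
  \<comment> \<open>The density \<open>I\<close> belongs to the averaged channel itself, so its
    expectation is linear in the averaged joint law and unfolds exactly into an expectation over the
    block.\<close>
  have "real n * mutual_info P W
      = real n * (\<Sum>x\<in>UNIV. \<Sum>y\<in>UNIV. avg_joint P n ?u x y * I x y)"
    by (simp add: mutual_info_def joint I_def)
  also have "\<dots> = (\<Sum>xs\<in>words n. seq_prob P xs * (\<Sum>i<n. I (xs ! i) (?u xs ! i)))"
    using \<open>0 < n\<close> by (simp add: sum_avg_joint)
  also have "\<dots> = (\<Sum>xs\<in>words n. seq_prob P xs * log 2 (r xs / seq_prob P xs))"
  proof (intro sum.cong refl)
    fix xs :: "'a list" assume "xs \<in> words n"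
    then show "seq_prob P xs * (\<Sum>i<n. I (xs ! i) (?u xs ! i)) = seq_prob P xs * log 2 (r xs / seq_prob P xs)"
      using nonneg[of xs] log_r[of xs] by (cases "seq_prob P xs = 0") auto
  qed
  also have "\<dots> \<le> log 2 (real M)"
  proof (rule gibbs_log)
    show "0 < real M" using \<open>0 < card (h ` words n)\<close> M by simp
    show "0 \<le> r xs" for xs unfolding r_def by (intro seq_prob_nonneg T0)
  qed (use nonneg r_pos r_sum sum_seq_prob_pmf[OF P] in auto)
  finally show ?thesis .
qed

text \<open>This is H(X^n|f) = n H(X) - H(f) with H(f) \<le> log M. The bound on H(f) is Gibbs'
  inequality against the probability of a word given its message, whose total mass is at most the
  number of messages.\<close>

lemma block_cond_entropy_ge:
  fixes P :: "'a::finite \<Rightarrow> real" and f :: "'a list \<Rightarrow> 'm"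
  assumes P: "pmf_on P" and M: "card (f ` words n) \<le> M"
  shows "real n * source_entropy P - log 2 (real M) \<le> block_cond_entropy P n f"
proof -
  have P0: "0 \<le> P x" for x using P by (simp add: pmf_on_def)
  have nonneg: "0 \<le> seq_prob P xs" for xs by (rule seq_prob_nonneg) (rule P0)
  define q where "q m = (\<Sum>ys\<in>{ys. length ys = n \<and> f ys = m}. seq_prob P ys)" for m
  have fin: "finite {ys. length ys = n \<and> f ys = m}" for m
    by (rule finite_subset[OF _ finite_words[of n]]) auto
  have q0: "0 \<le> q m" for m unfolding q_def by (intro sum_nonneg nonneg)
  have le_q: "seq_prob P xs \<le> q (f xs)" if "length xs = n" for xs
    unfolding q_def using that fin nonneg by (intro member_le_sum) auto
  have "words n \<noteq> ({} :: 'a list set)"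
    by (auto intro: exI[of _ "replicate n undefined"])
  then have "0 < card (f ` words n)" by (simp add: card_gt_0_iff)
  have entropy: "real n * source_entropy P = - (\<Sum>xs\<in>words n. seq_prob P xs * log 2 (seq_prob P xs))"
  proof -
    have "seq_prob P xs * log 2 (seq_prob P xs) = seq_prob P xs * sum_list (map (\<lambda>x. log 2 (P x)) xs)" for xs
    proof (cases "seq_prob P xs = 0")
      case False
      then have "0 < seq_prob P xs" using nonneg[of xs] by simp
      then have "log 2 (seq_prob P xs) = sum_list (map (\<lambda>x. log 2 (P x)) xs)"
        using P0 by (intro log_seq_prob) (auto simp: seq_prob_pos_iff)
      then show ?thesis by simp
    qed simp
    then have "(\<Sum>xs\<in>words n. seq_prob P xs * log 2 (seq_prob P xs))
        = (\<Sum>xs\<in>words n. seq_prob P xs * sum_list (map (\<lambda>x. log 2 (P x)) xs))"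
      by (intro sum.cong refl)
    then show ?thesis
      by (simp add: expectation_sum_list[OF P] source_entropy_def)
  qed
  have "(\<Sum>xs\<in>words n. seq_prob P xs * log 2 (seq_prob P xs / q (f xs) / seq_prob P xs)) \<le> log 2 (real M)"
  proof (rule gibbs_log)
    show "0 < real M" using \<open>0 < card (f ` words n)\<close> M by simp
    have "(\<Sum>xs\<in>words n. seq_prob P xs / q (f xs))
        = (\<Sum>m\<in>f ` words n. \<Sum>xs\<in>{xs \<in> words n. f xs = m}. seq_prob P xs / q (f xs))"
      by (rule sum.image_gen) simp
    also have "\<dots> = (\<Sum>m\<in>f ` words n. q m / q m)"
      unfolding q_def sum_divide_distrib by (intro sum.cong) auto
    also have "\<dots> \<le> (\<Sum>m\<in>f ` words n. 1)"
      by (intro sum_mono) simp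
    also have "\<dots> \<le> real M" using M by simp
    finally show "(\<Sum>xs\<in>words n. seq_prob P xs / q (f xs)) \<le> real M" .
    show "0 < seq_prob P xs / q (f xs)" if "xs \<in> words n" "0 < seq_prob P xs" for xs
      using le_q[of xs] that by simp
  qed (use nonneg q0 sum_seq_prob_pmf[OF P] in auto)
  moreover have split: "seq_prob P xs * log 2 (q (f xs) / seq_prob P xs)
      = - (seq_prob P xs * log 2 (seq_prob P xs))
        - seq_prob P xs * log 2 (seq_prob P xs / q (f xs) / seq_prob P xs)" if "length xs = n" for xs
  proof (cases "seq_prob P xs = 0")
    case False
    then have "0 < seq_prob P xs" "0 < q (f xs)" using nonneg[of xs] le_q[OF that] by auto
    then show ?thesis by (simp add: log_divide algebra_simps)
  qed simp
  have "block_cond_entropy P n f = (\<Sum>xs\<in>words n. - (seq_prob P xs * log 2 (seq_prob P xs))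
        - seq_prob P xs * log 2 (seq_prob P xs / q (f xs) / seq_prob P xs))"
    unfolding block_cond_entropy_def q_def[symmetric] by (intro sum.cong) (auto simp: split)
  then have "block_cond_entropy P n f = real n * source_entropy P
     - (\<Sum>xs\<in>words n. seq_prob P xs * log 2 (seq_prob P xs / q (f xs) / seq_prob P xs))"
    by (simp only: entropy sum_subtractf sum_negf)
  ultimately show ?thesis by simp
qed

section \<open>Continuity of mutual information, compactness, and the limit of codes\<close>

lemma continuous_on_x_log_x: "continuous_on {0..} (\<lambda>t::real. t * log 2 t)"
  unfolding continuous_on_def
proof
  fix t :: real assume "t \<in> {0..}"
  show "((\<lambda>t. t * log 2 t) \<longlongrightarrow> t * log 2 t) (at t within {0..})"
  proof (cases "t = 0")
    case True
    have "((\<lambda>t::real. t * log 2 t) \<longlongrightarrow> 0) (at_right 0)" by real_asymp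
    then show ?thesis using True by (simp add: at_within_Ici_at_right)
  next
    case False
    with \<open>t \<in> {0..}\<close> show ?thesis by (auto intro!: tendsto_intros)
  qed
qed

lemma tendsto_mutual_info:
  fixes P :: "'a::finite \<Rightarrow> real" and W :: "nat \<Rightarrow> 'a \<Rightarrow> 'b::finite \<Rightarrow> real"
  assumes P: "\<And>x. 0 \<le> P x" and W: "\<And>k. channel (W k)" "channel V"
    and lim: "\<And>x y. (\<lambda>k. W k x y) \<longlonglongrightarrow> V x y"
  shows "(\<lambda>k. mutual_info P (W k)) \<longlonglongrightarrow> mutual_info P V"
proof -
  have eta: "(\<lambda>k. s k * log 2 (s k)) \<longlonglongrightarrow> l * log 2 l"
    if "s \<longlonglongrightarrow> l" "\<And>k. 0 \<le> s k" "0 \<le> l" for s :: "nat \<Rightarrow> real" and l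
    using continuous_on_tendsto_compose[OF continuous_on_x_log_x that(1)] that by auto
  have out: "(\<lambda>k. out_dist P (W k) y) \<longlonglongrightarrow> out_dist P V y" for y
    unfolding out_dist_def by (intro tendsto_intros lim)
  show ?thesis
    unfolding mutual_info_eq_entropy_diff[OF P W(1)] mutual_info_eq_entropy_diff[OF P W(2)]
    by (intro tendsto_intros eta lim out out_dist_nonneg P W)
      (use W in \<open>auto simp: channel_def\<close>)
qed

text \<open>Entries lie in [0,1], so the laws form a bounded set in a finite-dimensional Euclidean
  space indexed by triples. Bolzano-Weierstrass applies there, and the defining conditions survive
  coordinatewise limits.\<close>

lemma cond_pmf2_convergent_subseq:
  fixes Q :: "nat \<Rightarrow> 'a::finite \<Rightarrow> 'b::finite \<Rightarrow> 'b \<Rightarrow> real"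
  assumes Q: "\<And>k. cond_pmf2 (Q k)"
  obtains L s where "cond_pmf2 L" "strict_mono s"
    "\<And>x y1 y2. (\<lambda>k. Q (s k) x y1 y2) \<longlonglongrightarrow> L x y1 y2"
proof -
  define v :: "nat \<Rightarrow> real ^ ('a \<times> 'b \<times> 'b)" where "v k = (\<chi> z. Q k (fst z) (fst (snd z)) (snd (snd z)))" for k
  have Q0: "0 \<le> Q k x y1 y2" for k x y1 y2 using Q[of k] by (simp add: cond_pmf2_def)
  have Q1: "Q k x y1 y2 \<le> 1" for k x y1 y2
  proof -
    have "Q k x y1 y2 \<le> (\<Sum>y2\<in>UNIV. Q k x y1 y2)"
      using Q0 by (intro member_le_sum) auto
    also have "\<dots> \<le> (\<Sum>y1\<in>UNIV. \<Sum>y2\<in>UNIV. Q k x y1 y2)"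
      using Q0 by (intro member_le_sum) (auto intro: sum_nonneg)
    finally show ?thesis using Q[of k] by (simp add: cond_pmf2_def)
  qed
  have "norm (v k) \<le> real CARD('a \<times> 'b \<times> 'b)" for k
  proof -
    have "norm (v k) \<le> (\<Sum>z\<in>UNIV. \<bar>v k $ z\<bar>)" by (rule norm_le_l1_cart)
    also have "\<dots> \<le> (\<Sum>z\<in>(UNIV :: ('a \<times> 'b \<times> 'b) set). 1)"
      by (intro sum_mono) (simp add: v_def Q0 Q1)
    also have "\<dots> = real CARD('a \<times> 'b \<times> 'b)" by simp
    finally show ?thesis .
  qed
  then have "bounded (range v)" by (auto intro: boundedI)
  then obtain l s where s: "strict_mono s" "(v \<circ> s) \<longlonglongrightarrow> l"
    using bounded_imp_convergent_subsequence by blast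
  define L where "L x y1 y2 = l $ (x, y1, y2)" for x y1 y2
  have lim: "(\<lambda>k. Q (s k) x y1 y2) \<longlonglongrightarrow> L x y1 y2" for x y1 y2
    using tendsto_vec_nth[OF s(2), of "(x, y1, y2)"] by (simp add: v_def L_def comp_def)
  have "(\<lambda>k. \<Sum>y1\<in>UNIV. \<Sum>y2\<in>UNIV. Q (s k) x y1 y2) \<longlonglongrightarrow> (\<Sum>y1\<in>UNIV. \<Sum>y2\<in>UNIV. L x y1 y2)" for x
    by (intro tendsto_intros lim)
  then have "(\<Sum>y1\<in>UNIV. \<Sum>y2\<in>UNIV. L x y1 y2) = 1" for x
    using Q by (simp add: cond_pmf2_def LIMSEQ_const_iff)
  moreover have "0 \<le> L x y1 y2" for x y1 y2
    by (rule LIMSEQ_le_const[OF lim]) (use Q0 in auto)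
  ultimately show thesis using that[of L s] s lim by (simp add: cond_pmf2_def)
qed

text \<open>The position average is taken of the zipped pair of reproductions, not of each
  separately, so that both averaged channels are marginals of a single \<open>Q\<close>. The pair is
  decoded from both messages, of which there are at most M1 * M2; this gives the sum rate.\<close>

lemma two_stage_code_single_letter:
  fixes P :: "'a::finite \<Rightarrow> real" and g :: "'a \<Rightarrow> 'b::finite \<Rightarrow> real"
    and f1 f2 :: "'a list \<Rightarrow> nat" and \<phi>1 :: "nat \<Rightarrow> 'b list" and \<phi>2 :: "nat \<Rightarrow> nat \<Rightarrow> 'b list"
  assumes P: "pmf_on P" and "0 < n"
    and f: "\<And>xs. length xs = n \<Longrightarrow> f1 xs < M1 \<and> f2 xs < M2"
    and rate: "real M1 \<le> 2 powr (real n * \<rho>1)" "real M2 \<le> 2 powr (real n * \<rho>2)"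
    and len: "\<And>w. length (\<phi>1 w) = n" "\<And>w v. length (\<phi>2 w v) = n"
  obtains Q where "cond_pmf2 Q"
    "exp_dist P (marg1 Q) g = block_dist P g n (\<lambda>xs. \<phi>1 (f1 xs))"
    "exp_dist P (marg2 Q) g = block_dist P g n (\<lambda>xs. \<phi>2 (f1 xs) (f2 xs))"
    "mutual_info P (marg1 Q) \<le> \<rho>1" "mutual_info P (pair_channel Q) \<le> \<rho>1 + \<rho>2"
proof -
  let ?u1 = "\<lambda>xs. \<phi>1 (f1 xs)" and ?u2 = "\<lambda>xs. \<phi>2 (f1 xs) (f2 xs)"
  let ?u = "\<lambda>xs. zip (?u1 xs) (?u2 xs)"
  define Q where "Q x y1 y2 = avg_channel P n ?u x (y1, y2)" for x y1 y2
  have pair: "pair_channel Q = avg_channel P n ?u"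
    by (simp add: Q_def pair_channel_def fun_eq_iff)
  have Q: "cond_pmf2 Q"
    using channel_avg_channel[OF P \<open>0 < n\<close>, of ?u] by (simp flip: pair channel_pair_iff)
  have PQ: "P x * Q x y1 y2 = avg_joint P n ?u x (y1, y2)" for x y1 y2
    by (simp add: Q_def avg_channel_joint[OF P \<open>0 < n\<close>])
  \<comment> \<open>One statement for both marginals: \<open>k\<close> inserts the coordinate being
    summed out next to the fixed letter \<open>c\<close>.\<close>
  have proj: "(\<Sum>y\<in>UNIV. avg_joint P n ?u x (k y)) = avg_joint P n v x c"
    if "\<And>xs i. i < n \<Longrightarrow> (\<Sum>y\<in>UNIV. of_bool (?u xs ! i = k y)) = (of_bool (v xs ! i = c) :: real)"
    for k :: "'b \<Rightarrow> 'b \<times> 'b" and v :: "'a list \<Rightarrow> 'b list" and x c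
  proof -
    have inner: "(\<Sum>y\<in>UNIV. \<Sum>i<n. of_bool (xs ! i = x \<and> ?u xs ! i = k y))
        = (\<Sum>i<n. of_bool (xs ! i = x \<and> v xs ! i = c) :: real)" for xs
    proof -
      have "(\<Sum>y\<in>UNIV. \<Sum>i<n. of_bool (xs ! i = x \<and> ?u xs ! i = k y))
          = (\<Sum>i<n. \<Sum>y\<in>UNIV. of_bool (xs ! i = x \<and> ?u xs ! i = k y) :: real)"
        by (rule sum.swap)
      also have "\<dots> = (\<Sum>i<n. of_bool (xs ! i = x) * (\<Sum>y\<in>UNIV. of_bool (?u xs ! i = k y)))"
        by (simp only: of_bool_conj sum_distrib_left)
      also have "\<dots> = (\<Sum>i<n. of_bool (xs ! i = x \<and> v xs ! i = c))"
        by (intro sum.cong refl) (simp only: that of_bool_conj lessThan_iff)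
      finally show ?thesis .
    qed
    have "(\<Sum>y\<in>UNIV. avg_joint P n ?u x (k y)) = (\<Sum>xs\<in>words n. \<Sum>y\<in>UNIV. seq_prob P xs *
        (\<Sum>i<n. of_bool (xs ! i = x \<and> ?u xs ! i = k y))) / real n"
      unfolding avg_joint_def sum_divide_distrib[symmetric] by (subst sum.swap) (rule refl)
    also have "\<dots> = avg_joint P n v x c"
      by (simp only: inner avg_joint_def sum_distrib_left[symmetric])
    finally show ?thesis .
  qed
  have joint1: "P x * marg1 Q x y = avg_joint P n ?u1 x y" for x y
  proof -
    have "(\<Sum>y2\<in>UNIV. of_bool (?u xs ! i = (y, y2))) = (of_bool (?u1 xs ! i = y) :: real)"
      if "i < n" for xs i
      using that by (cases "?u1 xs ! i = y") (simp_all add: len of_bool_def)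
    then show ?thesis by (simp add: marg1_def sum_distrib_left PQ proj)
  qed
  have joint2: "P x * marg2 Q x y = avg_joint P n ?u2 x y" for x y
  proof -
    have "(\<Sum>y1\<in>UNIV. of_bool (?u xs ! i = (y1, y))) = (of_bool (?u2 xs ! i = y) :: real)"
      if "i < n" for xs i
      using that by (cases "?u2 xs ! i = y") (simp_all add: len of_bool_def)
    then show ?thesis by (simp add: marg2_def sum_distrib_left PQ proj)
  qed
  have M: "0 < M1" "0 < M2" using f[of "replicate n undefined"] by auto
  have log_M: "log 2 (real M1) \<le> real n * \<rho>1" "log 2 (real M2) \<le> real n * \<rho>2"
    using rate M by (simp_all add: log_le_iff)
  have "f1 ` words n \<subseteq> {..<M1}" using f by auto
  then have card1: "card (f1 ` words n) \<le> M1"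
    using card_mono[of "{..<M1}"] by simp
  have "(\<lambda>xs. (f1 xs, f2 xs)) ` words n \<subseteq> {..<M1} \<times> {..<M2}" using f by auto
  then have card2: "card ((\<lambda>xs. (f1 xs, f2 xs)) ` words n) \<le> M1 * M2"
    using card_mono[of "{..<M1} \<times> {..<M2}"] by simp
  have "real n * mutual_info P (marg1 Q) \<le> log 2 (real M1)"
    using P channel_marg1[OF Q] \<open>0 < n\<close> joint1 len(1) card1
    by (intro rate_ge_mutual_info[where h = f1 and \<psi> = \<phi>1])
  with log_M have I1: "mutual_info P (marg1 Q) \<le> \<rho>1"
    using \<open>0 < n\<close> by (meson mult_le_cancel_left_pos of_nat_0_less_iff order_trans)
  have "real n * mutual_info P (pair_channel Q) \<le> log 2 (real (M1 * M2))"
  proof (rule rate_ge_mutual_info[where h = "\<lambda>xs. (f1 xs, f2 xs)"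
        and \<psi> = "\<lambda>(w, v). zip (\<phi>1 w) (\<phi>2 w v)"])
    show "P x * pair_channel Q x z = avg_joint P n (\<lambda>xs. (\<lambda>(w, v). zip (\<phi>1 w) (\<phi>2 w v)) (f1 xs, f2 xs)) x z"
      for x z
      by (simp add: pair avg_channel_joint[OF P \<open>0 < n\<close>])
  qed (use P Q channel_pair_iff \<open>0 < n\<close> len card2 in auto)
  also have "\<dots> = log 2 (real M1) + log 2 (real M2)" using M by (simp add: log_mult)
  also have "\<dots> \<le> real n * (\<rho>1 + \<rho>2)" using log_M by (simp add: algebra_simps)
  finally have I2: "mutual_info P (pair_channel Q) \<le> \<rho>1 + \<rho>2" using \<open>0 < n\<close> by simp
  show thesis
    using that[OF Q] exp_dist_avg_joint[OF joint1] exp_dist_avg_joint[OF joint2] I1 I2 by simp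
qed

lemma successive_disclosure_converse:
  fixes P :: "'a::finite \<Rightarrow> real" and g :: "'a \<Rightarrow> 'b::finite \<Rightarrow> real"
  assumes P: "pmf_on P"
    and feas: "rde_feasible P g D1 E1" "rde_feasible P g D2 E2"
    and ach: "successive_disclosure_achievable P g D1 E1 D2 E2"
  obtains Q :: "'a \<Rightarrow> 'b \<Rightarrow> 'b \<Rightarrow> real" where "cond_pmf2 Q"
    "exp_dist P (marg1 Q) g \<le> D1" "exp_dist P (marg2 Q) g \<le> D2"
    "RDE P g D1 E1 = mutual_info P (marg1 Q)" "RDE P g D2 E2 = mutual_info P (marg2 Q)"
    "markov_X_Y2_Y1 P Q"
proof -
  have P0: "0 \<le> P x" for x using P by (simp add: pmf_on_def)
  define R1 where "R1 = RDE P g D1 E1"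
  define R2 where "R2 = RDE P g D2 E2"
  define \<delta> where "\<delta> k = inverse (real (Suc k))" for k
  have "\<exists>Q :: 'a \<Rightarrow> 'b \<Rightarrow> 'b \<Rightarrow> real. cond_pmf2 Q \<and> exp_dist P (marg1 Q) g \<le> D1 + \<delta> k \<and> exp_dist P (marg2 Q) g \<le> D2 + \<delta> k
      \<and> mutual_info P (marg1 Q) \<le> R1 + \<delta> k \<and> mutual_info P (pair_channel Q) \<le> R2 + 2 * \<delta> k" for k
  proof -
    have "0 < \<delta> k" by (simp add: \<delta>_def)
    note ach[unfolded successive_disclosure_achievable_def two_stage_achievable_def,
        folded R1_def R2_def, rule_format, OF this]
    \<comment> \<open>One positive blocklength for each tolerance is enough; the limit is then taken
      along the tolerances.\<close>
    from eventually_conj[OF this eventually_gt_at_top[of 0]] have "\<exists>n. 0 < n \<and> (\<exists>M1 M2 f1 f2 \<phi>1 \<phi>2.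
          (\<forall>xs. length xs = n \<longrightarrow> f1 xs < M1 \<and> f2 xs < M2) \<and>
          real M1 \<le> 2 powr (real n * (R1 + \<delta> k)) \<and>
          real M2 \<le> 2 powr (real n * (R2 - R1 + \<delta> k)) \<and>
          (\<forall>w. length (\<phi>1 w) = n) \<and> (\<forall>w v. length (\<phi>2 w v) = n) \<and>
          block_dist P g n (\<lambda>xs. \<phi>1 (f1 xs)) \<le> D1 + \<delta> k \<and>
          block_dist P g n (\<lambda>xs. \<phi>2 (f1 xs) (f2 xs)) \<le> D2 + \<delta> k)"
      by (auto dest!: eventually_happens' [OF sequentially_bot]) blast
    then obtain n M1 M2 f1 f2 \<phi>1 \<phi>2 where n: "0 < n"
      and f: "\<And>xs. length xs = n \<Longrightarrow> f1 xs < M1 \<and> f2 xs < M2"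
      and rate: "real M1 \<le> 2 powr (real n * (R1 + \<delta> k))" "real M2 \<le> 2 powr (real n * (R2 - R1 + \<delta> k))"
      and len: "\<And>w. length (\<phi>1 w) = n" "\<And>w v. length (\<phi>2 w v) = n"
      and dist: "block_dist P g n (\<lambda>xs. \<phi>1 (f1 xs)) \<le> D1 + \<delta> k"
        "block_dist P g n (\<lambda>xs. \<phi>2 (f1 xs) (f2 xs)) \<le> D2 + \<delta> k"
      by blast
    obtain Q where "cond_pmf2 Q"
      "exp_dist P (marg1 Q) g = block_dist P g n (\<lambda>xs. \<phi>1 (f1 xs))"
      "exp_dist P (marg2 Q) g = block_dist P g n (\<lambda>xs. \<phi>2 (f1 xs) (f2 xs))"
      "mutual_info P (marg1 Q) \<le> R1 + \<delta> k"
      "mutual_info P (pair_channel Q) \<le> R1 + \<delta> k + (R2 - R1 + \<delta> k)"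
      by (rule two_stage_code_single_letter[where g = g, OF P n f rate len])
    with dist show ?thesis by (intro exI[of _ Q]) simp
  qed
  then obtain Q :: "nat \<Rightarrow> 'a \<Rightarrow> 'b \<Rightarrow> 'b \<Rightarrow> real" where Q: "\<And>k. cond_pmf2 (Q k)"
    and bounds: "\<And>k. exp_dist P (marg1 (Q k)) g \<le> D1 + \<delta> k" "\<And>k. exp_dist P (marg2 (Q k)) g \<le> D2 + \<delta> k"
      "\<And>k. mutual_info P (marg1 (Q k)) \<le> R1 + \<delta> k" "\<And>k. mutual_info P (pair_channel (Q k)) \<le> R2 + 2 * \<delta> k"
    by metis
  obtain L s where L: "cond_pmf2 L" and s: "strict_mono s"
    and lim: "\<And>x y1 y2. (\<lambda>k. Q (s k) x y1 y2) \<longlonglongrightarrow> L x y1 y2"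
    by (rule cond_pmf2_convergent_subseq[where Q = Q, OF Q]) (rule that, assumption+)
  have "\<delta> \<longlonglongrightarrow> 0" unfolding \<delta>_def by (rule LIMSEQ_inverse_real_of_nat)
  then have \<delta>: "(\<lambda>k. \<delta> (s k)) \<longlonglongrightarrow> 0"
    using LIMSEQ_subseq_LIMSEQ[of \<delta> 0 s] s by (simp add: comp_def)
  have lim1: "(\<lambda>k. marg1 (Q (s k)) x y) \<longlonglongrightarrow> marg1 L x y"
    and lim2: "(\<lambda>k. marg2 (Q (s k)) x y) \<longlonglongrightarrow> marg2 L x y"
    and lim12: "(\<lambda>k. pair_channel (Q (s k)) x z) \<longlonglongrightarrow> pair_channel L x z" for x y z
    unfolding marg1_def marg2_def pair_channel_def by (intro tendsto_intros lim)+
  have "(\<lambda>k. exp_dist P (marg1 (Q (s k))) g) \<longlonglongrightarrow> exp_dist P (marg1 L) g"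
    "(\<lambda>k. D1 + \<delta> (s k)) \<longlonglongrightarrow> D1 + 0"
    unfolding exp_dist_def by (intro tendsto_intros lim1 \<delta>)+
  then have dist1: "exp_dist P (marg1 L) g \<le> D1"
    using bounds(1) by (auto intro: LIMSEQ_le)
  have "(\<lambda>k. exp_dist P (marg2 (Q (s k))) g) \<longlonglongrightarrow> exp_dist P (marg2 L) g"
    "(\<lambda>k. D2 + \<delta> (s k)) \<longlonglongrightarrow> D2 + 0"
    unfolding exp_dist_def by (intro tendsto_intros lim2 \<delta>)+
  then have dist2: "exp_dist P (marg2 L) g \<le> D2"
    using bounds(2) by (auto intro: LIMSEQ_le)
  have "(\<lambda>k. mutual_info P (marg1 (Q (s k)))) \<longlonglongrightarrow> mutual_info P (marg1 L)"
    by (intro tendsto_mutual_info lim1 P0 channel_marg1 Q L)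
  moreover have "(\<lambda>k. R1 + \<delta> (s k)) \<longlonglongrightarrow> R1 + 0"
    by (intro tendsto_intros \<delta>)
  ultimately have I1: "mutual_info P (marg1 L) \<le> R1"
    using bounds(3) by (auto intro: LIMSEQ_le)
  have "(\<lambda>k. mutual_info P (pair_channel (Q (s k)))) \<longlonglongrightarrow> mutual_info P (pair_channel L)"
    using Q L by (intro tendsto_mutual_info lim12 P0) (auto simp: channel_pair_iff)
  moreover have "(\<lambda>k. R2 + 2 * \<delta> (s k)) \<longlonglongrightarrow> R2 + 2 * 0"
    by (intro tendsto_intros \<delta>)
  ultimately have I12: "mutual_info P (pair_channel L) \<le> R2"
    using bounds(4) by (auto intro: LIMSEQ_le)
  have R1: "R1 = mutual_info P (marg1 L)"
    unfolding R1_def using I1 by (intro RDE_eq_mutual_infoI P feas channel_marg1 L dist1) (simp add: R1_def)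
  have R2: "R2 = mutual_info P (marg2 L)"
    unfolding R2_def using I12 mutual_info_marg2_le[OF P L]
    by (intro RDE_eq_mutual_infoI P feas channel_marg2 L dist2) (simp add: R2_def)
  have "markov_X_Y2_Y1 P L"
    using I12 R2 by (intro markov_if_mutual_info_le P L) simp
  with R1 R2 L dist1 dist2 show thesis using that[of L] by (simp add: R1_def R2_def)
qed

subsection \<open>Achievability\<close>

text \<open>The existence step of random coding: some codeword does no worse than the mean under the
  codeword distribution \<open>v\<close>.\<close>

lemma weighted_average_attained:
  fixes v F :: "'c \<Rightarrow> real"
  assumes "finite S" and v: "\<And>c. c \<in> S \<Longrightarrow> 0 \<le> v c" "sum v S = 1"
  shows "\<exists>c\<in>S. F c \<le> (\<Sum>c\<in>S. v c * F c)"
proof (rule ccontr)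
  let ?m = "\<Sum>c\<in>S. v c * F c"
  assume "\<not> ?thesis"
  then have less: "?m < F c" if "c \<in> S" for c using that by auto
  obtain c where c: "c \<in> S" "v c \<noteq> 0"
    using v(2) by (metis sum.neutral zero_neq_one)
  have "(\<Sum>c\<in>S. v c * ?m) < (\<Sum>c\<in>S. v c * F c)"
    using \<open>finite S\<close>
  proof (rule sum_strict_mono_ex1)
    show "\<forall>c\<in>S. v c * ?m \<le> v c * F c"
      by (intro ballI mult_left_mono less_imp_le[OF less] v(1))
    have "0 < v c" using c v(1)[of c] by simp
    then show "\<exists>c\<in>S. v c * ?m < v c * F c"
      using c(1) less[OF c(1)] by (intro bexI[of _ c] mult_strict_left_mono) auto
  qed
  then show False using v(2) by (simp flip: sum_distrib_right)
qed

text \<open>Derandomised random coding: choosing the codewords one after the other, each no worse than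
  average for the weights left by the later ones, achieves the mean performance of an i.i.d.\ codebook.\<close>

lemma codebook_exists:
  fixes h :: "'c \<Rightarrow> 'x \<Rightarrow> real" and b :: "'x \<Rightarrow> real"
  assumes one: "\<And>w. (\<And>x. x \<in> A \<Longrightarrow> 0 \<le> w x) \<Longrightarrow>
      \<exists>c\<in>S. (\<Sum>x\<in>A. w x * h c x) \<le> (\<Sum>x\<in>A. w x * b x)"
    and h: "\<And>c x. c \<in> S \<Longrightarrow> x \<in> A \<Longrightarrow> 0 \<le> h c x" and b: "\<And>x. x \<in> A \<Longrightarrow> 0 \<le> b x"
    and w: "\<And>x. x \<in> A \<Longrightarrow> 0 \<le> w x"
  shows "\<exists>cs. length cs = M \<and> set cs \<subseteq> S \<and>
      (\<Sum>x\<in>A. w x * prod_list (map (\<lambda>c. h c x) cs)) \<le> (\<Sum>x\<in>A. w x * b x ^ M)"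
  using w
proof (induction M arbitrary: w)
  case 0
  then show ?case by simp
next
  case (Suc M)
  \<comment> \<open>The factor b x ^ M stands for the \<open>M\<close> codewords still to be chosen;
    afterwards the factor h c x of the chosen word joins the weights, which is why \<open>w\<close>
    is generalised in the induction.\<close>
  obtain c where c: "c \<in> S" "(\<Sum>x\<in>A. (w x * b x ^ M) * h c x) \<le> (\<Sum>x\<in>A. (w x * b x ^ M) * b x)"
    using one[of "\<lambda>x. w x * b x ^ M"] Suc.prems b by auto
  obtain cs where cs: "length cs = M" "set cs \<subseteq> S"
    "(\<Sum>x\<in>A. (w x * h c x) * prod_list (map (\<lambda>c. h c x) cs)) \<le> (\<Sum>x\<in>A. (w x * h c x) * b x ^ M)"
    using Suc.IH[of "\<lambda>x. w x * h c x"] Suc.prems h[OF c(1)] by auto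
  have "(\<Sum>x\<in>A. w x * prod_list (map (\<lambda>c. h c x) (c # cs))) \<le> (\<Sum>x\<in>A. w x * b x ^ Suc M)"
    using cs(3) c(2) by (simp add: mult_ac)
  then show ?case using c cs by (intro exI[of _ "c # cs"]) auto
qed

text \<open>After (1 - p)^M \<le> exp(- M q t), convexity of exp on the segment from 0 to - M t
  separates \<open>q\<close> from the exponential. In the covering lemma \<open>q\<close> is the
  chance of success under the true joint law, and \<open>t\<close> the reciprocal of the price of
  drawing independently instead.\<close>

lemma one_minus_power_le:
  fixes p q t :: real
  assumes "0 \<le> q" "q \<le> 1" "q * t \<le> p" "p \<le> 1"
  shows "(1 - p) ^ M \<le> 1 - q + exp (- (real M * t))"
proof -
  have "(1 - p) ^ M \<le> exp (- p) ^ M"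
    using assms exp_ge_add_one_self[of "-p"] by (intro power_mono) auto
  also have "\<dots> = exp (- (real M * p))" by (simp flip: exp_of_nat_mult)
  also have "\<dots> \<le> exp (- (real M * (q * t)))"
    using assms by (simp add: mult_left_mono)
  also have "\<dots> = exp ((1 - q) *\<^sub>R 0 + q *\<^sub>R (- (real M * t)))" by (simp add: algebra_simps)
  also have "\<dots> \<le> (1 - q) * exp 0 + q * exp (- (real M * t))"
    using assms by (intro convex_onD[OF exp_convex]) auto
  also have "\<dots> \<le> 1 - q + exp (- (real M * t))"
    using assms by (simp add: mult_left_le_one_le)
  finally show ?thesis .
qed

lemma prod_list_of_bool:
  "prod_list (map (\<lambda>c. of_bool (R c)) cs) = (of_bool (\<forall>c\<in>set cs. R c) :: real)"
  by (induction cs) auto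

text \<open>One-shot superposition covering. \<open>K1\<close> and \<open>K2\<close> are the prices,
  on the good event, of drawing the centre from \<open>p1\<close> and a satellite from V y
  independently of x instead of from the joint law. One draw then succeeds with at least 1 / K of
  the true conditional probability, and the power inequality above is applied once per
  layer.\<close>

lemma two_stage_covering:
  fixes J :: "'x \<Rightarrow> 'y \<Rightarrow> 'z \<Rightarrow> real"
  assumes fin: "finite A" "finite B1" "finite B2"
    and J: "\<And>x y z. 0 \<le> J x y z"
    and J1: "\<And>x y. x \<in> A \<Longrightarrow> y \<in> B1 \<Longrightarrow> J1 x y = (\<Sum>z\<in>B2. J x y z)"
    and P: "\<And>x. x \<in> A \<Longrightarrow> P x = (\<Sum>y\<in>B1. J1 x y)" "sum P A = 1"
    and p1: "\<And>y. 0 \<le> p1 y" "sum p1 B1 = 1"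
    and V: "\<And>y z. 0 \<le> V y z" "\<And>y. y \<in> B1 \<Longrightarrow> (\<Sum>z\<in>B2. V y z) = 1"
    and K: "0 < K1" "0 < K2"
    and G1: "\<And>x y z. x \<in> A \<Longrightarrow> y \<in> B1 \<Longrightarrow> z \<in> B2 \<Longrightarrow> G x y z \<Longrightarrow> J1 x y \<le> K1 * (P x * p1 y)"
    and G2: "\<And>x y z. x \<in> A \<Longrightarrow> y \<in> B1 \<Longrightarrow> z \<in> B2 \<Longrightarrow> G x y z \<Longrightarrow> J x y z \<le> K2 * (J1 x y * V y z)"
  shows "\<exists>cs. length cs = M1 \<and> (\<forall>c\<in>set cs. fst c \<in> B1 \<and> length (snd c) = M2 \<and> set (snd c) \<subseteq> B2) \<and>
     (\<Sum>x\<in>A. P x * of_bool (\<forall>c\<in>set cs. \<forall>z\<in>set (snd c). \<not> G x (fst c) z))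
      \<le> 1 - (\<Sum>x\<in>A. \<Sum>y\<in>B1. \<Sum>z\<in>B2. J x y z * of_bool (G x y z))
          + exp (- (real M2 / K2)) + exp (- (real M1 / K1))"
proof -
  \<comment> \<open>For a source point x, \<open>p\<close> is the chance that one random satellite
    of y is good, and \<open>b\<close> the chance that a random centre fails with all its
    \<open>M2\<close> satellites. An element of \<open>S\<close> is a centre together with its whole
    satellite list, so a cluster counts as one codeword of the outer book.\<close>
  define p where "p x y = (\<Sum>z\<in>B2. V y z * of_bool (G x y z))" for x y
  define b where "b x = (\<Sum>y\<in>B1. p1 y * (1 - p x y) ^ M2)" for x
  define S where "S = {c :: 'y \<times> 'z list. fst c \<in> B1 \<and> length (snd c) = M2 \<and> set (snd c) \<subseteq> B2}"
  define h where "h c x = (of_bool (\<forall>z\<in>set (snd c). \<not> G x (fst c) z) :: real)" for c :: "'y \<times> 'z list" and x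
  have p0: "0 \<le> p x y" for x y
    unfolding p_def using V by (intro sum_nonneg) auto
  have p_le1: "p x y \<le> 1" if "y \<in> B1" for x y
  proof -
    have "p x y \<le> (\<Sum>z\<in>B2. V y z)"
      unfolding p_def using V by (intro sum_mono) auto
    then show ?thesis using V(2)[OF that] by simp
  qed
  have J10: "0 \<le> J1 x y" if "x \<in> A" "y \<in> B1" for x y
    using J J1[OF that] by (simp add: sum_nonneg)
  have P0: "0 \<le> P x" if "x \<in> A" for x
    using J10 P(1)[OF that] that by (simp add: sum_nonneg)
  have b0: "0 \<le> b x" for x
    unfolding b_def using p1 p_le1 by (intro sum_nonneg mult_nonneg_nonneg zero_le_power) auto
  have inner: "\<exists>zs. length zs = M2 \<and> set zs \<subseteq> B2 \<and>
      (\<Sum>x\<in>A. w x * prod_list (map (\<lambda>z. of_bool (\<not> G x y z)) zs)) \<le> (\<Sum>x\<in>A. w x * (1 - p x y) ^ M2)"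
    if y: "y \<in> B1" and w: "\<And>x. x \<in> A \<Longrightarrow> 0 \<le> w x" for y and w :: "'x \<Rightarrow> real"
  proof (rule codebook_exists)
    fix w :: "'x \<Rightarrow> real" assume "\<And>x. x \<in> A \<Longrightarrow> 0 \<le> w x"
    have "\<exists>z\<in>B2. (\<Sum>x\<in>A. w x * of_bool (\<not> G x y z))
        \<le> (\<Sum>z\<in>B2. V y z * (\<Sum>x\<in>A. w x * of_bool (\<not> G x y z)))"
      using fin V y by (intro weighted_average_attained) auto
    also have "(\<Sum>z\<in>B2. V y z * (\<Sum>x\<in>A. w x * of_bool (\<not> G x y z)))
        = (\<Sum>x\<in>A. \<Sum>z\<in>B2. w x * (V y z - V y z * of_bool (G x y z)))"
      unfolding sum_distrib_left by (subst sum.swap) (intro sum.cong refl, auto)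
    also have "\<dots> = (\<Sum>x\<in>A. w x * (1 - p x y))"
      using V(2)[OF y] by (simp add: p_def sum_subtractf flip: sum_distrib_left)
    finally show "\<exists>z\<in>B2. (\<Sum>x\<in>A. w x * of_bool (\<not> G x y z)) \<le> (\<Sum>x\<in>A. w x * (1 - p x y))" .
  qed (use p_le1 y w in auto)
  \<comment> \<open>Some centre does no worse than average for the given weights, and with it fixed
    \<open>inner\<close> provides its satellites. A whole cluster thus meets the one-codeword
    hypothesis of \<open>codebook_exists\<close> with mean failure \<open>b\<close>.\<close>
  have outer: "\<exists>c\<in>S. (\<Sum>x\<in>A. w x * h c x) \<le> (\<Sum>x\<in>A. w x * b x)"
    if w: "\<And>x. x \<in> A \<Longrightarrow> 0 \<le> w x" for w :: "'x \<Rightarrow> real"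
  proof -
    have "\<exists>y\<in>B1. (\<Sum>x\<in>A. w x * (1 - p x y) ^ M2) \<le> (\<Sum>y\<in>B1. p1 y * (\<Sum>x\<in>A. w x * (1 - p x y) ^ M2))"
      using fin p1 by (intro weighted_average_attained) auto
    also have "(\<Sum>y\<in>B1. p1 y * (\<Sum>x\<in>A. w x * (1 - p x y) ^ M2)) = (\<Sum>x\<in>A. w x * b x)"
      unfolding b_def sum_distrib_left by (subst sum.swap) (simp add: mult_ac)
    finally obtain y where y: "y \<in> B1" "(\<Sum>x\<in>A. w x * (1 - p x y) ^ M2) \<le> (\<Sum>x\<in>A. w x * b x)"
      by blast
    obtain zs where zs: "length zs = M2" "set zs \<subseteq> B2"
      "(\<Sum>x\<in>A. w x * prod_list (map (\<lambda>z. of_bool (\<not> G x y z)) zs)) \<le> (\<Sum>x\<in>A. w x * (1 - p x y) ^ M2)"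
      using inner[OF y(1), of w] w by blast
    have "(\<Sum>x\<in>A. w x * h (y, zs) x) \<le> (\<Sum>x\<in>A. w x * b x)"
      using zs(3) y(2) by (simp only: h_def prod_list_of_bool fst_conv snd_conv)
    then show ?thesis using y zs by (intro bexI[of _ "(y, zs)"]) (auto simp: S_def)
  qed
  obtain cs where cs: "length cs = M1" "set cs \<subseteq> S"
    "(\<Sum>x\<in>A. P x * prod_list (map (\<lambda>c. h c x) cs)) \<le> (\<Sum>x\<in>A. P x * b x ^ M1)"
    using codebook_exists[where A = A and S = S and h = h and b = b and w = P and M = M1, OF outer] P0 b0
    by (auto simp: h_def)
  let ?\<eta>2 = "exp (- (real M2 / K2))" and ?\<eta>1 = "exp (- (real M1 / K1))"
  define s where "s x = (\<Sum>y\<in>B1. \<Sum>z\<in>B2. J x y z * of_bool (G x y z))" for x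
  have bound: "P x * b x ^ M1 \<le> P x - s x + P x * (?\<eta>2 + ?\<eta>1)" if x: "x \<in> A" for x
  proof (cases "P x = 0")
    case True
    then have "J1 x y = 0" if "y \<in> B1" for y
      using P(1)[OF x] J10[OF x] fin(2) that sum_nonneg_eq_0_iff[of B1 "J1 x"] by simp
    then have "J x y z = 0" if "y \<in> B1" "z \<in> B2" for y z
      using J1[OF x that(1)] J fin(3) that sum_nonneg_eq_0_iff[of B2 "J x y"] by simp
    then show ?thesis using True by (simp add: s_def)
  next
    case False
    with P0[OF x] have Px: "0 < P x" by simp
    \<comment> \<open>The conditional probability of the good event given x and y under the true
      law; it is 0 when the pair has no mass.\<close>
    define q where "q y = (\<Sum>z\<in>B2. J x y z * of_bool (G x y z)) / J1 x y" for y
    have G_le: "(\<Sum>z\<in>B2. J x y z * of_bool (G x y z)) \<le> J1 x y" if "y \<in> B1" for y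
      using J unfolding J1[OF x that] by (intro sum_mono) auto
    have G_0: "0 \<le> (\<Sum>z\<in>B2. J x y z * of_bool (G x y z))" for y
      using J by (intro sum_nonneg) auto
    have q01: "0 \<le> q y" "q y \<le> 1" and J1_q: "J1 x y * q y = (\<Sum>z\<in>B2. J x y z * of_bool (G x y z))"
      if "y \<in> B1" for y
      using G_le[OF that] G_0[of y] J10[OF x that] by (auto simp: q_def divide_le_eq_1)
    have "q y * (1 / K2) \<le> p x y" if y: "y \<in> B1" for y
    proof -
      have "J x y z * of_bool (G x y z) / J1 x y / K2 \<le> V y z * of_bool (G x y z)" if "z \<in> B2" for z
      proof (cases "G x y z \<and> J1 x y \<noteq> 0")
        case True
        then have "0 < J1 x y" using J10[OF x y] by simp
        then show ?thesis
          using G2[OF x y that] True K by (simp add: divide_le_eq mult_ac)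
      qed (use V in auto)
      then have "(\<Sum>z\<in>B2. J x y z * of_bool (G x y z) / J1 x y / K2) \<le> p x y"
        unfolding p_def by (rule sum_mono)
      then show ?thesis by (simp add: q_def sum_divide_distrib)
    qed
    then have stage2: "(1 - p x y) ^ M2 \<le> 1 - q y + ?\<eta>2" if "y \<in> B1" for y
      using one_minus_power_le[of "q y" "1 / K2" "p x y" M2] q01[OF that] p_le1[OF that] that by simp
    \<comment> \<open>Change of measure for the centre. The comparison \<open>G1\<close> is
      available only if some z is good; otherwise q y = 0 and the left side is at most zero.\<close>
    have "J1 x y / P x / K1 * (q y - ?\<eta>2) \<le> p1 y * (1 - (1 - p x y) ^ M2)" if y: "y \<in> B1" for y
    proof -
      have nonneg: "0 \<le> 1 - (1 - p x y) ^ M2"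
        using p0[of x y] p_le1[OF y] by (simp add: power_le_one)
      have coeff: "0 \<le> J1 x y / P x / K1" using J10[OF x y] Px K by simp
      show ?thesis
      proof (cases "\<exists>z\<in>B2. G x y z")
        case True
        then have "J1 x y / P x / K1 \<le> p1 y"
          using G1[OF x y] Px K by (auto simp: divide_le_eq mult_ac)
        have "J1 x y / P x / K1 * (q y - ?\<eta>2) \<le> J1 x y / P x / K1 * (1 - (1 - p x y) ^ M2)"
          using stage2[OF y] coeff by (intro mult_left_mono) auto
        also have "\<dots> \<le> p1 y * (1 - (1 - p x y) ^ M2)"
          using \<open>J1 x y / P x / K1 \<le> p1 y\<close> nonneg by (rule mult_right_mono)
        finally show ?thesis .
      next
        case False
        then have "q y = 0" by (simp add: q_def)
        then have "J1 x y / P x / K1 * (q y - ?\<eta>2) \<le> 0"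
          using coeff by (intro mult_nonneg_nonpos) auto
        also have "\<dots> \<le> p1 y * (1 - (1 - p x y) ^ M2)" using p1 nonneg by simp
        finally show ?thesis .
      qed
    qed
    then have "(\<Sum>y\<in>B1. J1 x y / P x / K1 * (q y - ?\<eta>2)) \<le> (\<Sum>y\<in>B1. p1 y * (1 - (1 - p x y) ^ M2))"
      by (rule sum_mono)
    also have "\<dots> = 1 - b x"
      using p1(2) by (simp add: b_def right_diff_distrib sum_subtractf)
    also have "(\<Sum>y\<in>B1. J1 x y / P x / K1 * (q y - ?\<eta>2)) = (\<Sum>y\<in>B1. J1 x y * q y - J1 x y * ?\<eta>2) / P x / K1"
      by (simp add: sum_divide_distrib right_diff_distrib diff_divide_distrib)
    also have "(\<Sum>y\<in>B1. J1 x y * q y - J1 x y * ?\<eta>2) = s x - P x * ?\<eta>2"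
      by (simp add: sum_subtractf s_def J1_q P(1)[OF x] flip: sum_distrib_right)
    finally have hit: "(s x / P x - ?\<eta>2) * (1 / K1) \<le> 1 - b x"
      using Px by (simp add: diff_divide_distrib)
    have "b x \<le> (\<Sum>y\<in>B1. p1 y * 1)"
      unfolding b_def using p0 p_le1 p1 by (intro sum_mono mult_left_mono power_le_one) auto
    then have "b x \<le> 1" using p1 by simp
    have "s x \<le> (\<Sum>y\<in>B1. J1 x y)"
      unfolding s_def by (intro sum_mono G_le)
    then have "s x / P x \<le> 1" using P(1)[OF x] Px by simp
    \<comment> \<open>The success bound may be negative after subtracting the satellite error, while
      \<open>one_minus_power_le\<close> needs a probability. Truncating at 0 only increases it, so
      the resulting failure bound still implies the untruncated one.\<close>
    define q' where "q' = max 0 (s x / P x - ?\<eta>2)"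
    have "(1 - (1 - b x)) ^ M1 \<le> 1 - q' + exp (- (real M1 * (1 / K1)))"
    proof (rule one_minus_power_le)
      show "q' \<le> 1"
        using \<open>s x / P x \<le> 1\<close> exp_gt_zero[of "- (real M2 / K2)"] unfolding q'_def by linarith
      show "q' * (1 / K1) \<le> 1 - b x"
        using hit \<open>b x \<le> 1\<close> by (simp add: q'_def max_def)
    qed (use b0[of x] in \<open>simp_all add: q'_def\<close>)
    then have "b x ^ M1 \<le> 1 - (s x / P x - ?\<eta>2) + ?\<eta>1"
      unfolding q'_def by simp
    then have "P x * b x ^ M1 \<le> P x * (1 - (s x / P x - ?\<eta>2) + ?\<eta>1)"
      using Px by (intro mult_left_mono) auto
    then show ?thesis using Px by (simp add: algebra_simps)
  qed
  have "(\<Sum>x\<in>A. P x * of_bool (\<forall>c\<in>set cs. \<forall>z\<in>set (snd c). \<not> G x (fst c) z)) \<le> (\<Sum>x\<in>A. P x * b x ^ M1)"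
    using cs(3) by (simp only: h_def prod_list_of_bool)
  also have "\<dots> \<le> (\<Sum>x\<in>A. P x - s x + P x * (?\<eta>2 + ?\<eta>1))"
    by (rule sum_mono) (rule bound)
  also have "\<dots> = 1 - sum s A + ?\<eta>2 + ?\<eta>1"
    using P(2) by (simp add: sum.distrib sum_subtractf flip: sum_distrib_right)
  finally show ?thesis
    using cs(1,2) unfolding s_def S_def by (intro exI[of _ cs]) auto
qed

section \<open>Typical words and the block codebook\<close>

text \<open>A union bound over Chebyshev's inequality for each \<open>F\<close>.\<close>

lemma typical_mass:
  fixes J :: "'c::finite \<Rightarrow> real" and Fs :: "('c \<Rightarrow> real) set"
  assumes J: "pmf_on J" and "finite Fs" "0 < \<delta>" "0 < n"
  defines "\<mu> \<equiv> \<lambda>F. \<Sum>z\<in>UNIV. J z * F z"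
  shows "1 - (\<Sum>F\<in>Fs. \<Sum>z\<in>UNIV. J z * (F z - \<mu> F)\<^sup>2) / (real n * \<delta>\<^sup>2)
    \<le> (\<Sum>zs\<in>words n. seq_prob J zs * of_bool (\<forall>F\<in>Fs. sum_list (map F zs) \<le> real n * (\<mu> F + \<delta>)))"
proof -
  have nonneg: "0 \<le> seq_prob J zs" for zs
    using J by (intro seq_prob_nonneg) (simp add: pmf_on_def)
  let ?bad = "\<lambda>F zs. of_bool (sum_list (map F zs) > real n * (\<mu> F + \<delta>)) :: real"
  have "1 - of_bool (\<forall>F\<in>Fs. sum_list (map F zs) \<le> real n * (\<mu> F + \<delta>)) \<le> (\<Sum>F\<in>Fs. ?bad F zs)" for zs
  proof (cases "\<forall>F\<in>Fs. sum_list (map F zs) \<le> real n * (\<mu> F + \<delta>)")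
    case True
    then show ?thesis by (simp add: sum_nonneg)
  next
    case False
    then obtain F where F: "F \<in> Fs" "sum_list (map F zs) > real n * (\<mu> F + \<delta>)" by auto
    have "?bad F zs \<le> (\<Sum>F\<in>Fs. ?bad F zs)"
      using \<open>finite Fs\<close> F(1) by (intro member_le_sum) auto
    then have "1 \<le> (\<Sum>F\<in>Fs. ?bad F zs)" using F(2) by simp
    then show ?thesis using False by simp
  qed
  then have "(\<Sum>zs\<in>words n. seq_prob J zs * (1 - of_bool (\<forall>F\<in>Fs. sum_list (map F zs) \<le> real n * (\<mu> F + \<delta>))))
      \<le> (\<Sum>zs\<in>words n. seq_prob J zs * (\<Sum>F\<in>Fs. ?bad F zs))"
    using nonneg by (intro sum_mono mult_left_mono) auto
  also have "\<dots> = (\<Sum>F\<in>Fs. \<Sum>zs\<in>words n. seq_prob J zs * ?bad F zs)"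
    unfolding sum_distrib_left by (rule sum.swap)
  also have "\<dots> \<le> (\<Sum>F\<in>Fs. (\<Sum>z\<in>UNIV. J z * (F z - \<mu> F)\<^sup>2) / (real n * \<delta>\<^sup>2))"
  proof (rule sum_mono)
    fix F
    have "(\<Sum>zs\<in>words n. seq_prob J zs * ?bad F zs)
        = (\<Sum>zs\<in>{zs\<in>words n. sum_list (map F zs) > real n * (\<mu> F + \<delta>)}. seq_prob J zs)"
      by (rule sum.mono_neutral_cong_right) auto
    also have "\<dots> \<le> (\<Sum>z\<in>UNIV. J z * (F z - \<mu> F)\<^sup>2) / (real n * \<delta>\<^sup>2)"
      unfolding \<mu>_def by (rule chebyshev_sum_list) (use assms in auto)
    finally show "(\<Sum>zs\<in>words n. seq_prob J zs * ?bad F zs) \<le> (\<Sum>z\<in>UNIV. J z * (F z - \<mu> F)\<^sup>2) / (real n * \<delta>\<^sup>2)" .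
  qed
  finally show ?thesis
    using sum_seq_prob_pmf[OF J, of n] by (simp add: right_diff_distrib sum_subtractf sum_divide_distrib)
qed

text \<open>Turns a typicality condition on an empirical log-ratio into a change-of-measure
  inequality as required by \<open>two_stage_covering\<close>.\<close>

lemma seq_prob_le_of_log_ratio:
  fixes F H :: "'c \<Rightarrow> real"
  assumes pos: "\<And>z. z \<in> set zs \<Longrightarrow> 0 < F z" "\<And>z. z \<in> set zs \<Longrightarrow> 0 < H z"
    and "sum_list (map (\<lambda>z. log 2 (F z / H z)) zs) \<le> c"
  shows "seq_prob F zs \<le> 2 powr c * seq_prob H zs"
proof -
  have "seq_prob F zs = seq_prob (\<lambda>z. F z / H z * H z) zs"
    by (intro seq_prob_cong) (use pos(2) in \<open>simp add: less_imp_neq[symmetric]\<close>)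
  also have "\<dots> = seq_prob (\<lambda>z. F z / H z) zs * seq_prob H zs"
    by (rule seq_prob_mult)
  also have "seq_prob (\<lambda>z. F z / H z) zs \<le> 2 powr c"
  proof -
    have "0 < seq_prob (\<lambda>z. F z / H z) zs" using pos by (intro seq_prob_pos) auto
    moreover have "log 2 (seq_prob (\<lambda>z. F z / H z) zs) \<le> c"
      using pos assms(3) by (subst log_seq_prob) auto
    ultimately show ?thesis by (simp add: log_le_iff)
  qed
  finally show ?thesis
    using seq_prob_pos[of zs H] pos by (simp add: mult_right_mono)
qed

text \<open>\<open>two_stage_covering\<close> for product laws, with joint typicality as the good
  event. \<open>C\<close> is fixed before the blocklength: it is the total variance of the four test
  functions divided by the square of \<delta>.\<close>

lemma two_stage_typical_codebook:
  fixes P :: "'a::finite \<Rightarrow> real" and Q :: "'a \<Rightarrow> 'b::finite \<Rightarrow> 'b \<Rightarrow> real" and g :: "'a \<Rightarrow> 'b \<Rightarrow> real"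
  assumes P: "pmf_on P" and Q: "cond_pmf2 Q" and "0 < \<delta>"
  defines "I1 \<equiv> mutual_info P (marg1 Q)" and "I12 \<equiv> mutual_info P (pair_channel Q)"
    and "d1 \<equiv> exp_dist P (marg1 Q) g" and "d2 \<equiv> exp_dist P (marg2 Q) g"
  obtains C where "\<forall>n M1 M2. 0 < n \<longrightarrow>
     (\<exists>cs :: ('b list \<times> 'b list list) list. length cs = M1 \<and>
       (\<forall>c\<in>set cs. length (fst c) = n \<and> length (snd c) = M2 \<and> (\<forall>ys\<in>set (snd c). length ys = n)) \<and>
       (\<Sum>xs\<in>words n. seq_prob P xs * of_bool (\<forall>c\<in>set cs. \<forall>ys\<in>set (snd c).
           \<not> ((\<Sum>i<n. g (xs ! i) (fst c ! i)) \<le> real n * (d1 + \<delta>)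
              \<and> (\<Sum>i<n. g (xs ! i) (ys ! i)) \<le> real n * (d2 + \<delta>))))
       \<le> C / real n + exp (- (real M2 / 2 powr (real n * (I12 - I1 + \<delta>))))
           + exp (- (real M1 / 2 powr (real n * (I1 + \<delta>)))))"
proof -
  have P0: "0 \<le> P x" for x using P by (simp add: pmf_on_def)
  have Q0: "0 \<le> Q x y1 y2" for x y1 y2 using Q by (simp add: cond_pmf2_def)
  define p1 where "p1 = out_dist P (marg1 Q)"
  define p12 where "p12 = out_dist P (pair_channel Q)"
  define J where "J = (\<lambda>((x, y1), y2). P x * Q x y1 y2)"
  define J1 where "J1 = (\<lambda>(x, y1). P x * marg1 Q x y1)"
  \<comment> \<open>The satellite law p(y2|y1), set to uniform where y1 has no mass so that it
    remains a kernel.\<close>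
  define V where "V = (\<lambda>(y1, y2). if p1 y1 = 0 then 1 / real CARD('b) else p12 (y1, y2) / p1 y1)"
  \<comment> \<open>\<open>F1\<close> and \<open>F2\<close> are the information densities of X;Y1
    and of X;Y2 given Y1, \<open>F3\<close> and \<open>F4\<close> the two distortions. Their means
    under \<open>J\<close> are \<open>I1\<close>, \<open>I12\<close> - \<open>I1\<close>,
    \<open>d1\<close> and \<open>d2\<close>.\<close>
  define F1 where "F1 z = log 2 (J1 (fst z) / (P (fst (fst z)) * p1 (snd (fst z))))" for z :: "('a \<times> 'b) \<times> 'b"
  define F2 where "F2 z = log 2 (J z / (J1 (fst z) * V (snd (fst z), snd z)))" for z :: "('a \<times> 'b) \<times> 'b"
  define F3 where "F3 z = g (fst (fst z)) (snd (fst z))" for z :: "('a \<times> 'b) \<times> 'b"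
  define F4 where "F4 z = g (fst (fst z)) (snd z)" for z :: "('a \<times> 'b) \<times> 'b"
  define Fs where "Fs = {F1, F2, F3, F4}"
  define \<mu> where "\<mu> F = (\<Sum>z\<in>UNIV. J z * F z)" for F
  define C where "C = (\<Sum>F\<in>Fs. \<Sum>z\<in>UNIV. J z * (F z - \<mu> F)\<^sup>2) / \<delta>\<^sup>2"
  have J0: "0 \<le> J z" for z using P0 Q0 by (auto simp: J_def split: prod.split)
  have p10: "0 \<le> p1 y" for y
    unfolding p1_def using P0 channel_marg1[OF Q] by (rule out_dist_nonneg)
  have p120: "0 \<le> p12 z" for z
    unfolding p12_def using P0 Q by (intro out_dist_nonneg) (auto simp: channel_pair_iff)
  have V0: "0 \<le> V z" for z using p10 p120 by (auto simp: V_def split: prod.split)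
  have J_pmf: "pmf_on J"
    using P Q J0 by (simp add: J_def sum_UNIV_prod cond_pmf2_def pmf_on_def flip: sum_distrib_left)
  have sum_J: "(\<Sum>y2\<in>UNIV. J (z, y2)) = J1 z" for z
    by (simp add: J_def J1_def marg1_def sum_distrib_left split: prod.split)
  have sum_J1: "(\<Sum>y1\<in>UNIV. J1 (x, y1)) = P x" for x
    using channel_marg1[OF Q] by (simp add: J1_def channel_def flip: sum_distrib_left)
  have sum_p1: "sum p1 UNIV = 1"
    unfolding p1_def using sum_out_dist[OF channel_marg1[OF Q]] P by (simp add: pmf_on_def)
  have p1_eq: "p1 y1 = (\<Sum>y2\<in>UNIV. p12 (y1, y2))" for y1
    unfolding p1_def p12_def out_dist_def marg1_def pair_channel_def sum_distrib_left
    by (simp, rule sum.swap)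
  have sum_V: "(\<Sum>y2\<in>UNIV. V (y1, y2)) = 1" for y1
    by (cases "p1 y1 = 0") (simp_all add: V_def p1_eq flip: sum_divide_distrib)
  have pos: "0 < J1 (x, y1)" "0 < P x" "0 < p1 y1" "0 < V (y1, y2)" "0 < Q x y1 y2" "0 < marg1 Q x y1" "0 < p12 (y1, y2)"
    if "0 < J ((x, y1), y2)" for x y1 y2
  proof -
    have "0 < P x * Q x y1 y2" using that by (simp add: J_def)
    note * = pair_channel_positivity[OF P Q this]
    show "0 < J1 (x, y1)" "0 < P x" "0 < p1 y1" "0 < V (y1, y2)" "0 < Q x y1 y2" "0 < marg1 Q x y1" "0 < p12 (y1, y2)"
      using * by (simp_all add: J1_def V_def p1_def p12_def)
  qed
  have sumJ: "(\<Sum>z\<in>UNIV. J z * F z) = (\<Sum>x\<in>UNIV. \<Sum>y1\<in>UNIV. \<Sum>y2\<in>UNIV. P x * Q x y1 y2 * F ((x, y1), y2))" for F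
    by (simp add: sum_UNIV_prod J_def)
  have termJ: "P x * Q x y1 y2 * a = P x * Q x y1 y2 * b" if "0 < J ((x, y1), y2) \<Longrightarrow> a = b" for x y1 y2 a b
    using that J0[of "((x, y1), y2)"] by (cases "P x * Q x y1 y2 = 0") (auto simp: J_def less_le)
  have "\<mu> F1 = (\<Sum>x\<in>UNIV. \<Sum>y1\<in>UNIV. \<Sum>y2\<in>UNIV. P x * Q x y1 y2 * log 2 (marg1 Q x y1 / p1 y1))"
    unfolding \<mu>_def sumJ
  proof (intro sum.cong refl termJ)
    fix x y1 y2 assume "0 < J ((x, y1), y2)"
    from pos[OF this] show "F1 ((x, y1), y2) = log 2 (marg1 Q x y1 / p1 y1)"
      by (simp add: F1_def J1_def)
  qed
  then have \<mu>1: "\<mu> F1 = I1"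
    by (simp add: I1_def mutual_info_def sum_marg1 p1_def)
  have "\<mu> F2 = (\<Sum>x\<in>UNIV. \<Sum>y1\<in>UNIV. \<Sum>y2\<in>UNIV. P x * Q x y1 y2
      * (log 2 (Q x y1 y2 / p12 (y1, y2)) - log 2 (marg1 Q x y1 / p1 y1)))"
    unfolding \<mu>_def sumJ
  proof (intro sum.cong refl termJ)
    fix x y1 y2 assume "0 < J ((x, y1), y2)"
    from pos[OF this] show "F2 ((x, y1), y2) = log 2 (Q x y1 y2 / p12 (y1, y2)) - log 2 (marg1 Q x y1 / p1 y1)"
      by (simp add: F2_def J_def J1_def V_def log_divide log_mult)
  qed
  then have \<mu>2: "\<mu> F2 = I12 - I1"
    by (simp add: I12_def mutual_info_pair p12_def right_diff_distrib sum_subtractf)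
      (simp add: I1_def mutual_info_def sum_marg1 p1_def)
  have \<mu>3: "\<mu> F3 = d1"
    by (simp add: \<mu>_def sumJ d1_def exp_dist_def sum_marg1 F3_def)
  have \<mu>4: "\<mu> F4 = d2"
    by (simp add: \<mu>_def sumJ d2_def exp_dist_def sum_marg2 F4_def)
  have code: "\<exists>cs :: ('b list \<times> 'b list list) list. length cs = M1 \<and>
       (\<forall>c\<in>set cs. length (fst c) = n \<and> length (snd c) = M2 \<and> (\<forall>ys\<in>set (snd c). length ys = n)) \<and>
       (\<Sum>xs\<in>words n. seq_prob P xs * of_bool (\<forall>c\<in>set cs. \<forall>ys\<in>set (snd c).
           \<not> ((\<Sum>i<n. g (xs ! i) (fst c ! i)) \<le> real n * (d1 + \<delta>)
              \<and> (\<Sum>i<n. g (xs ! i) (ys ! i)) \<le> real n * (d2 + \<delta>))))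
       \<le> C / real n + exp (- (real M2 / 2 powr (real n * (I12 - I1 + \<delta>))))
           + exp (- (real M1 / 2 powr (real n * (I1 + \<delta>))))" if "0 < n" for n M1 M2
  proof -
    define Z where "Z xs ys1 ys2 = zip (zip xs ys1) ys2" for xs :: "'a list" and ys1 ys2 :: "'b list"
    \<comment> \<open>Positive mass is part of the good event because the log-ratio bounds require
      every letter triple to lie in the support. The words excluded by it carry no
      probability.\<close>
    define G where "G xs ys1 ys2 \<longleftrightarrow> 0 < seq_prob J (Z xs ys1 ys2) \<and>
       (\<forall>F\<in>Fs. sum_list (map F (Z xs ys1 ys2)) \<le> real n * (\<mu> F + \<delta>))" for xs ys1 ys2
    let ?D = "\<lambda>xs ys1 ys2. (\<Sum>i<n. g (xs ! i) (ys1 ! i)) \<le> real n * (d1 + \<delta>)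
              \<and> (\<Sum>i<n. g (xs ! i) (ys2 ! i)) \<le> real n * (d2 + \<delta>)"
    let ?e2 = "exp (- (real M2 / 2 powr (real n * (I12 - I1 + \<delta>))))"
    let ?e1 = "exp (- (real M1 / 2 powr (real n * (I1 + \<delta>))))"
    have G_D: "?D xs ys1 ys2" if "G xs ys1 ys2" "length xs = n" "length ys1 = n" "length ys2 = n" for xs ys1 ys2
    proof -
      have "sum_list (map F3 (Z xs ys1 ys2)) \<le> real n * (d1 + \<delta>)"
        "sum_list (map F4 (Z xs ys1 ys2)) \<le> real n * (d2 + \<delta>)"
        using that(1) by (auto simp: G_def Fs_def \<mu>3 \<mu>4)
      then show ?thesis using that(2-4) by (simp add: sum_list_map_nth Z_def F3_def F4_def)
    qed
    \<comment> \<open>All word laws are pulled back to the single word of triples, where they can be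
      compared letter by letter.\<close>
    have rewr: "seq_prob J1 (zip xs ys1) = seq_prob (\<lambda>z. J1 (fst z)) (Z xs ys1 ys2)"
      "seq_prob P xs = seq_prob (\<lambda>z. P (fst (fst z))) (Z xs ys1 ys2)"
      "seq_prob p1 ys1 = seq_prob (\<lambda>z. p1 (snd (fst z))) (Z xs ys1 ys2)"
      "seq_prob V (zip ys1 ys2) = seq_prob (\<lambda>z. V (snd (fst z), snd z)) (Z xs ys1 ys2)"
      if "length xs = n" "length ys1 = n" "length ys2 = n" for xs ys1 ys2
    proof -
      have "zip xs ys1 = map fst (Z xs ys1 ys2)" "xs = map (\<lambda>z. fst (fst z)) (Z xs ys1 ys2)"
        "ys1 = map (\<lambda>z. snd (fst z)) (Z xs ys1 ys2)"
        "zip ys1 ys2 = map (\<lambda>z. (snd (fst z), snd z)) (Z xs ys1 ys2)"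
        using that by (auto simp: Z_def intro!: nth_equalityI)
      then show "seq_prob J1 (zip xs ys1) = seq_prob (\<lambda>z. J1 (fst z)) (Z xs ys1 ys2)"
        "seq_prob P xs = seq_prob (\<lambda>z. P (fst (fst z))) (Z xs ys1 ys2)"
        "seq_prob p1 ys1 = seq_prob (\<lambda>z. p1 (snd (fst z))) (Z xs ys1 ys2)"
        "seq_prob V (zip ys1 ys2) = seq_prob (\<lambda>z. V (snd (fst z), snd z)) (Z xs ys1 ys2)"
        by (metis seq_prob_map)+
    qed
    have Z_pos: "0 < J z" "0 < J1 (fst z)" "0 < P (fst (fst z))" "0 < p1 (snd (fst z))" "0 < V (snd (fst z), snd z)"
      if "G xs ys1 ys2" "z \<in> set (Z xs ys1 ys2)" for xs ys1 ys2 z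
    proof -
      show Jz: "0 < J z"
        using that seq_prob_pos_iff[of J] J0 by (auto simp: G_def)
      obtain x y1 y2 where "z = ((x, y1), y2)" by (cases z) auto
      with Jz pos[of x y1 y2] show "0 < J1 (fst z)" "0 < P (fst (fst z))" "0 < p1 (snd (fst z))" "0 < V (snd (fst z), snd z)"
        by auto
    qed
    have "\<exists>cs :: ('b list \<times> 'b list list) list. length cs = M1 \<and>
      (\<forall>c\<in>set cs. fst c \<in> words n \<and> length (snd c) = M2 \<and> set (snd c) \<subseteq> words n) \<and>
      (\<Sum>xs\<in>words n. seq_prob P xs * of_bool (\<forall>c\<in>set cs. \<forall>ys\<in>set (snd c). \<not> G xs (fst c) ys))
      \<le> 1 - (\<Sum>xs\<in>words n. \<Sum>ys1\<in>words n. \<Sum>ys2\<in>words n. seq_prob J (Z xs ys1 ys2) * of_bool (G xs ys1 ys2))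
          + ?e2 + ?e1"
    proof (rule two_stage_covering[where J = "\<lambda>xs ys1 ys2. seq_prob J (Z xs ys1 ys2)"
            and ?J1.0 = "\<lambda>xs ys1. seq_prob J1 (zip xs ys1)" and ?p1.0 = "seq_prob p1"
            and V = "\<lambda>ys1 ys2. seq_prob V (zip ys1 ys2)"])
      fix xs :: "'a list" and ys1 ys2 :: "'b list"
      show "0 \<le> seq_prob J (Z xs ys1 ys2)" by (intro seq_prob_nonneg J0)
      show "0 \<le> seq_prob p1 ys1" by (intro seq_prob_nonneg p10)
      show "0 \<le> seq_prob V (zip ys1 ys2)" by (intro seq_prob_nonneg V0)
      show "(\<Sum>ys2\<in>words n. seq_prob V (zip ys1 ys2)) = 1" if "ys1 \<in> words n"
        using that sum_seq_prob_zip[of V ys1] by (simp add: sum_V seq_prob_one)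
      assume xs: "xs \<in> words n"
      show "seq_prob P xs = (\<Sum>ys1\<in>words n. seq_prob J1 (zip xs ys1))"
        using xs sum_seq_prob_zip[of J1 xs] by (simp add: sum_J1)
      assume ys1: "ys1 \<in> words n"
      show "seq_prob J1 (zip xs ys1) = (\<Sum>ys2\<in>words n. seq_prob J (Z xs ys1 ys2))"
        using xs ys1 sum_seq_prob_zip[of J "zip xs ys1"] by (simp add: sum_J Z_def)
      assume "ys2 \<in> words n" and G: "G xs ys1 ys2"
      with xs ys1 have len: "length xs = n" "length ys1 = n" "length ys2 = n" by auto
      have F: "sum_list (map F1 (Z xs ys1 ys2)) \<le> real n * (I1 + \<delta>)"
        "sum_list (map F2 (Z xs ys1 ys2)) \<le> real n * (I12 - I1 + \<delta>)"
        using G by (auto simp: G_def Fs_def \<mu>1 \<mu>2)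
      show "seq_prob J1 (zip xs ys1) \<le> 2 powr (real n * (I1 + \<delta>)) * (seq_prob P xs * seq_prob p1 ys1)"
        unfolding rewr[OF len] seq_prob_mult[symmetric]
        using F(1) Z_pos[OF G] by (intro seq_prob_le_of_log_ratio) (auto simp: F1_def[abs_def])
      show "seq_prob J (Z xs ys1 ys2) \<le> 2 powr (real n * (I12 - I1 + \<delta>)) *
          (seq_prob J1 (zip xs ys1) * seq_prob V (zip ys1 ys2))"
        unfolding rewr[OF len] seq_prob_mult[symmetric]
        using F(2) Z_pos[OF G] by (intro seq_prob_le_of_log_ratio) (auto simp: F2_def[abs_def])
    qed (use P in \<open>simp_all add: pmf_on_def sum_seq_prob sum_p1\<close>)
    then obtain cs :: "('b list \<times> 'b list list) list" where cs: "length cs = M1"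
      "\<forall>c\<in>set cs. fst c \<in> words n \<and> length (snd c) = M2 \<and> set (snd c) \<subseteq> words n"
      and miss: "(\<Sum>xs\<in>words n. seq_prob P xs * of_bool (\<forall>c\<in>set cs. \<forall>ys\<in>set (snd c). \<not> G xs (fst c) ys))
      \<le> 1 - (\<Sum>xs\<in>words n. \<Sum>ys1\<in>words n. \<Sum>ys2\<in>words n. seq_prob J (Z xs ys1 ys2) * of_bool (G xs ys1 ys2))
          + ?e2 + ?e1"
      by blast
    have "(\<Sum>xs\<in>words n. \<Sum>ys1\<in>words n. \<Sum>ys2\<in>words n. seq_prob J (Z xs ys1 ys2) * of_bool (G xs ys1 ys2))
       = (\<Sum>zs\<in>words n. seq_prob J zs * of_bool (0 < seq_prob J zs \<and> (\<forall>F\<in>Fs. sum_list (map F zs) \<le> real n * (\<mu> F + \<delta>))))"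
      unfolding G_def Z_def
      by (subst sum_words_zip[where F = "\<lambda>us. \<Sum>ys2\<in>words n. seq_prob J (zip us ys2) * of_bool
            (0 < seq_prob J (zip us ys2) \<and> (\<forall>F\<in>Fs. sum_list (map F (zip us ys2)) \<le> real n * (\<mu> F + \<delta>)))"])
        (rule sum_words_zip[where F = "\<lambda>zs. seq_prob J zs * of_bool
            (0 < seq_prob J zs \<and> (\<forall>F\<in>Fs. sum_list (map F zs) \<le> real n * (\<mu> F + \<delta>)))"])
    also have "\<dots> = (\<Sum>zs\<in>words n. seq_prob J zs * of_bool (\<forall>F\<in>Fs. sum_list (map F zs) \<le> real n * (\<mu> F + \<delta>)))"
      using seq_prob_nonneg[of J] J0 by (intro sum.cong refl) (auto simp: less_le)
    also have "\<dots> \<ge> 1 - C / real n"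
      using typical_mass[OF J_pmf, of Fs \<delta> n] \<open>0 < \<delta>\<close> \<open>0 < n\<close>
      by (simp add: C_def \<mu>_def Fs_def mult.commute)
    finally have typical: "1 - C / real n
      \<le> (\<Sum>xs\<in>words n. \<Sum>ys1\<in>words n. \<Sum>ys2\<in>words n. seq_prob J (Z xs ys1 ys2) * of_bool (G xs ys1 ys2))" .
    have "(\<Sum>xs\<in>words n. seq_prob P xs * of_bool (\<forall>c\<in>set cs. \<forall>ys\<in>set (snd c). \<not> ?D xs (fst c) ys))
       \<le> (\<Sum>xs\<in>words n. seq_prob P xs * of_bool (\<forall>c\<in>set cs. \<forall>ys\<in>set (snd c). \<not> G xs (fst c) ys))"
    proof (intro sum_mono mult_left_mono seq_prob_nonneg P0)
      fix xs :: "'a list" assume "xs \<in> words n"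
      then have "\<not> G xs (fst c) ys" if "c \<in> set cs" "ys \<in> set (snd c)" "\<not> ?D xs (fst c) ys" for c ys
        using that G_D[of xs "fst c" ys] cs(2) by auto
      then show "(of_bool (\<forall>c\<in>set cs. \<forall>ys\<in>set (snd c). \<not> ?D xs (fst c) ys) :: real)
          \<le> of_bool (\<forall>c\<in>set cs. \<forall>ys\<in>set (snd c). \<not> G xs (fst c) ys)"
        unfolding of_bool_def by (auto simp del: de_Morgan_conj)
    qed
    then have "(\<Sum>xs\<in>words n. seq_prob P xs * of_bool (\<forall>c\<in>set cs. \<forall>ys\<in>set (snd c). \<not> ?D xs (fst c) ys))
       \<le> C / real n + ?e2 + ?e1"
      using miss typical by linarith
    then show ?thesis using cs by (intro exI[of _ cs]) auto
  qed
  show thesis by (rule that, intro allI impI, rule code)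
qed

section \<open>From codebooks to codes\<close>

text \<open>A covered word is charged \<open>t\<close>, a missed one t + \<Delta>, which dominates
  the largest letter distortion \<open>B\<close>.\<close>

lemma block_dist_le:
  fixes P :: "'a::finite \<Rightarrow> real"
  assumes P: "pmf_on P" and "0 < n" and B: "\<And>x y. g x y \<le> B" and "0 \<le> \<Delta>" "B \<le> t + \<Delta>"
    and hit: "\<And>xs. length xs = n \<Longrightarrow> \<not> miss xs \<Longrightarrow> (\<Sum>i<n. g (xs ! i) (u xs ! i)) \<le> real n * t"
    and p: "(\<Sum>xs\<in>words n. seq_prob P xs * of_bool (miss xs)) \<le> p"
  shows "block_dist P g n u \<le> t + \<Delta> * p"
proof -
  have "(\<Sum>i<n. g (xs ! i) (u xs ! i)) / real n \<le> t + \<Delta> * of_bool (miss xs)" if "length xs = n" for xs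
  proof (cases "miss xs")
    case True
    have "(\<Sum>i<n. g (xs ! i) (u xs ! i)) \<le> (\<Sum>i<n. B)" by (intro sum_mono B)
    then have "(\<Sum>i<n. g (xs ! i) (u xs ! i)) / real n \<le> B"
      using \<open>0 < n\<close> by (simp add: divide_le_eq mult.commute)
    then show ?thesis using True \<open>B \<le> t + \<Delta>\<close> by simp
  next
    case False
    then show ?thesis using hit[OF that] \<open>0 < n\<close> by (simp add: divide_le_eq mult.commute)
  qed
  then have "block_dist P g n u \<le> (\<Sum>xs\<in>words n. seq_prob P xs * (t + \<Delta> * of_bool (miss xs)))"
    unfolding block_dist_def using P
    by (intro sum_mono mult_left_mono seq_prob_nonneg) (auto simp: pmf_on_def)
  also have "\<dots> = (\<Sum>xs\<in>words n. seq_prob P xs) * t + \<Delta> * (\<Sum>xs\<in>words n. seq_prob P xs * of_bool (miss xs))"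
    by (simp only: distrib_left sum.distrib sum_distrib_left sum_distrib_right mult.left_commute)
  also have "\<dots> \<le> t + \<Delta> * p"
    using p \<open>0 \<le> \<Delta>\<close> by (simp add: sum_seq_prob_pmf[OF P] mult_left_mono)
  finally show ?thesis .
qed

text \<open>Both decoders share the first index, so the encoder must find a centre good for the
  first demand having a satellite good for the second; the codebook lemma controls exactly this
  joint event.\<close>

lemma two_stage_code_exists:
  fixes P :: "'a::finite \<Rightarrow> real" and Q :: "'a \<Rightarrow> 'b::finite \<Rightarrow> 'b \<Rightarrow> real" and g :: "'a \<Rightarrow> 'b \<Rightarrow> real"
  assumes P: "pmf_on P" and Q: "cond_pmf2 Q" and "0 < \<delta>"
  defines "I1 \<equiv> mutual_info P (marg1 Q)" and "I12 \<equiv> mutual_info P (pair_channel Q)"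
    and "d1 \<equiv> exp_dist P (marg1 Q) g" and "d2 \<equiv> exp_dist P (marg2 Q) g"
  obtains \<Delta> C where "0 \<le> \<Delta>" "\<forall>n M1 M2. 0 < n \<longrightarrow> 0 < M1 \<longrightarrow> 0 < M2 \<longrightarrow>
     (\<exists>(f1 :: 'a list \<Rightarrow> nat) (f2 :: 'a list \<Rightarrow> nat) (\<phi>1 :: nat \<Rightarrow> 'b list) (\<phi>2 :: nat \<Rightarrow> nat \<Rightarrow> 'b list) p.
       (\<forall>xs. f1 xs < M1 \<and> f2 xs < M2) \<and> (\<forall>w. length (\<phi>1 w) = n) \<and> (\<forall>w v. length (\<phi>2 w v) = n) \<and>
       block_dist P g n (\<lambda>xs. \<phi>1 (f1 xs)) \<le> d1 + \<delta> + \<Delta> * p \<and>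
       block_dist P g n (\<lambda>xs. \<phi>2 (f1 xs) (f2 xs)) \<le> d2 + \<delta> + \<Delta> * p \<and>
       p \<le> C / real n + exp (- (real M2 / 2 powr (real n * (I12 - I1 + \<delta>))))
           + exp (- (real M1 / 2 powr (real n * (I1 + \<delta>)))))"
proof -
  obtain C where C: "\<forall>n M1 M2. 0 < n \<longrightarrow>
     (\<exists>cs :: ('b list \<times> 'b list list) list. length cs = M1 \<and>
       (\<forall>c\<in>set cs. length (fst c) = n \<and> length (snd c) = M2 \<and> (\<forall>ys\<in>set (snd c). length ys = n)) \<and>
       (\<Sum>xs\<in>words n. seq_prob P xs * of_bool (\<forall>c\<in>set cs. \<forall>ys\<in>set (snd c).
           \<not> ((\<Sum>i<n. g (xs ! i) (fst c ! i)) \<le> real n * (d1 + \<delta>)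
              \<and> (\<Sum>i<n. g (xs ! i) (ys ! i)) \<le> real n * (d2 + \<delta>))))
       \<le> C / real n + exp (- (real M2 / 2 powr (real n * (I12 - I1 + \<delta>))))
           + exp (- (real M1 / 2 powr (real n * (I1 + \<delta>)))))"
    unfolding I1_def I12_def d1_def d2_def
    by (rule two_stage_typical_codebook[OF P Q \<open>0 < \<delta>\<close>, of g])
  define B where "B = (\<Sum>x\<in>UNIV. \<Sum>y\<in>UNIV. \<bar>g x y\<bar>)"
  have B: "g x y \<le> B" for x y
  proof -
    have "g x y \<le> \<bar>g x y\<bar>" by simp
    also have "\<dots> \<le> (\<Sum>y\<in>UNIV. \<bar>g x y\<bar>)" by (rule member_le_sum) auto
    also have "\<dots> \<le> B" unfolding B_def by (rule member_le_sum) (auto intro: sum_nonneg)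
    finally show ?thesis .
  qed
  define \<Delta> where "\<Delta> = \<bar>B\<bar> + \<bar>d1\<bar> + \<bar>d2\<bar>"
  have "0 \<le> \<Delta>" by (simp add: \<Delta>_def)
  have \<Delta>: "B \<le> d1 + \<delta> + \<Delta>" "B \<le> d2 + \<delta> + \<Delta>" using \<open>0 < \<delta>\<close> by (auto simp: \<Delta>_def)
  show thesis
  proof (rule that[OF \<open>0 \<le> \<Delta>\<close>], intro allI impI)
    fix n M1 M2 :: nat assume n: "0 < n" and M: "0 < M1" "0 < M2"
    let ?D = "\<lambda>xs ys1 ys2. (\<Sum>i<n. g (xs ! i) (ys1 ! i)) \<le> real n * (d1 + \<delta>)
              \<and> (\<Sum>i<n. g (xs ! i) (ys2 ! i)) \<le> real n * (d2 + \<delta>)"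
    obtain cs :: "('b list \<times> 'b list list) list" where cs: "length cs = M1"
      "\<And>c. c \<in> set cs \<Longrightarrow> length (fst c) = n \<and> length (snd c) = M2 \<and> (\<forall>ys\<in>set (snd c). length ys = n)"
      and p: "(\<Sum>xs\<in>words n. seq_prob P xs * of_bool (\<forall>c\<in>set cs. \<forall>ys\<in>set (snd c). \<not> ?D xs (fst c) ys))
       \<le> C / real n + exp (- (real M2 / 2 powr (real n * (I12 - I1 + \<delta>))))
           + exp (- (real M1 / 2 powr (real n * (I1 + \<delta>))))"
      using mp[OF spec[OF spec[OF spec[OF C, of n], of M1], of M2] n] by blast
    define miss where "miss xs \<longleftrightarrow> (\<forall>c\<in>set cs. \<forall>ys\<in>set (snd c). \<not> ?D xs (fst c) ys)" for xs
    \<comment> \<open>Decoders are total and must return words of length \<open>n\<close> even on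
      indices outside the message sets, hence the filler word.\<close>
    define \<phi>1 where "\<phi>1 w = (if w < M1 then fst (cs ! w) else replicate n undefined)" for w
    define \<phi>2 where "\<phi>2 w v = (if w < M1 \<and> v < M2 then snd (cs ! w) ! v else replicate n undefined)" for w v
    define ok where "ok xs wv \<longleftrightarrow> fst wv < M1 \<and> snd wv < M2 \<and>
        (\<not> miss xs \<longrightarrow> ?D xs (\<phi>1 (fst wv)) (\<phi>2 (fst wv) (snd wv)))" for xs wv
    have ex: "\<exists>wv. ok xs wv" for xs
    proof (cases "miss xs")
      case True
      then show ?thesis using M by (intro exI[of _ "(0, 0)"]) (simp add: ok_def)
    next
      case False
      then obtain c ys where c: "c \<in> set cs" "ys \<in> set (snd c)" "?D xs (fst c) ys"
        unfolding miss_def by blast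
      then obtain w v where "w < M1" "c = cs ! w" "v < length (snd c)" "ys = snd c ! v"
        using cs(1) by (metis in_set_conv_nth)
      with c cs(2)[OF c(1)] show ?thesis
        by (intro exI[of _ "(w, v)"]) (simp add: ok_def \<phi>1_def \<phi>2_def)
    qed
    define e where "e xs = (SOME wv. ok xs wv)" for xs
    have "ok xs (e xs)" for xs unfolding e_def by (rule someI_ex[OF ex])
    then have e: "fst (e xs) < M1" "snd (e xs) < M2"
      "\<not> miss xs \<Longrightarrow> ?D xs (\<phi>1 (fst (e xs))) (\<phi>2 (fst (e xs)) (snd (e xs)))" for xs
      unfolding ok_def by blast+
    let ?p = "\<Sum>xs\<in>words n. seq_prob P xs * of_bool (miss xs)"
    have "block_dist P g n (\<lambda>xs. \<phi>1 (fst (e xs))) \<le> d1 + \<delta> + \<Delta> * ?p"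
      using e(3) by (intro block_dist_le[where miss = miss and B = B] P n B \<open>0 \<le> \<Delta>\<close> \<Delta>) auto
    moreover have "block_dist P g n (\<lambda>xs. \<phi>2 (fst (e xs)) (snd (e xs))) \<le> d2 + \<delta> + \<Delta> * ?p"
      using e(3) by (intro block_dist_le[where miss = miss and B = B] P n B \<open>0 \<le> \<Delta>\<close> \<Delta>) auto
    moreover have "length (\<phi>1 w) = n" for w
      using cs by (simp add: \<phi>1_def)
    moreover have "length (\<phi>2 w v) = n" for w v
      using cs(1) cs(2)[of "cs ! w"] by (auto simp: \<phi>2_def)
    moreover have "?p \<le> C / real n + exp (- (real M2 / 2 powr (real n * (I12 - I1 + \<delta>))))
           + exp (- (real M1 / 2 powr (real n * (I1 + \<delta>))))"
      using p by (simp only: miss_def)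
    ultimately show "\<exists>(f1 :: 'a list \<Rightarrow> nat) (f2 :: 'a list \<Rightarrow> nat) (\<phi>1 :: nat \<Rightarrow> 'b list) (\<phi>2 :: nat \<Rightarrow> nat \<Rightarrow> 'b list) p.
       (\<forall>xs. f1 xs < M1 \<and> f2 xs < M2) \<and> (\<forall>w. length (\<phi>1 w) = n) \<and> (\<forall>w v. length (\<phi>2 w v) = n) \<and>
       block_dist P g n (\<lambda>xs. \<phi>1 (f1 xs)) \<le> d1 + \<delta> + \<Delta> * p \<and>
       block_dist P g n (\<lambda>xs. \<phi>2 (f1 xs) (f2 xs)) \<le> d2 + \<delta> + \<Delta> * p \<and>
       p \<le> C / real n + exp (- (real M2 / 2 powr (real n * (I12 - I1 + \<delta>))))
           + exp (- (real M1 / 2 powr (real n * (I1 + \<delta>))))"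
      using e(1,2) by (intro exI[of _ "\<lambda>xs. fst (e xs)"] exI[of _ "\<lambda>xs. snd (e xs)"] exI[of _ \<phi>1] exI[of _ \<phi>2]
          exI[of _ ?p]) simp
  qed
qed

text \<open>Here 2 powr r is a covering constant and \<open>t\<close> the excess exponent. Rounding
  down a number that is at least 1 loses at most a factor 2, so the covering error exp(- M / 2 powr
  r) stays doubly exponentially small when \<open>t\<close> is linear in the blocklength.\<close>

lemma nat_floor_powr_bounds:
  fixes r t :: real
  assumes "0 \<le> r" "0 \<le> t"
  defines "M \<equiv> nat \<lfloor>2 powr (r + t)\<rfloor>"
  shows "0 < M" "real M \<le> 2 powr (r + t)" "2 powr t / 2 \<le> real M / 2 powr r"
proof -
  have one: "1 \<le> 2 powr (r + t)" using assms by (intro ge_one_powr_ge_zero) auto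
  then have "1 \<le> \<lfloor>2 powr (r + t)\<rfloor>" by simp
  then show "0 < M" by (simp add: M_def)
  have M: "real M = of_int \<lfloor>2 powr (r + t)\<rfloor>" using \<open>1 \<le> \<lfloor>_\<rfloor>\<close> by (simp add: M_def)
  then show "real M \<le> 2 powr (r + t)" by simp
  have "2 powr (r + t) / 2 \<le> real M"
    using one M \<open>1 \<le> \<lfloor>_\<rfloor>\<close> floor_correct[of "2 powr (r + t)"] by linarith
  then show "2 powr t / 2 \<le> real M / 2 powr r"
    by (simp add: powr_add field_simps)
qed

lemma successive_disclosure_achievability:
  fixes P :: "'a::finite \<Rightarrow> real" and g :: "'a \<Rightarrow> 'b::finite \<Rightarrow> real" and Q :: "'a \<Rightarrow> 'b \<Rightarrow> 'b \<Rightarrow> real"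
  assumes P: "pmf_on P" and "D2 \<le> D1"
    and feas: "rde_feasible P g D1 E1" "rde_feasible P g D2 E2"
    and Q: "cond_pmf2 Q" and dist: "exp_dist P (marg1 Q) g \<le> D1" "exp_dist P (marg2 Q) g \<le> D2"
    and R: "RDE P g D1 E1 = mutual_info P (marg1 Q)" "RDE P g D2 E2 = mutual_info P (marg2 Q)"
    and markov: "markov_X_Y2_Y1 P Q"
  shows "successive_disclosure_achievable P g D1 E1 D2 E2"
  unfolding successive_disclosure_achievable_def two_stage_achievable_def
proof (intro allI impI)
  fix \<epsilon> :: real assume "0 < \<epsilon>"
  define R1 where "R1 = RDE P g D1 E1"
  define R2 where "R2 = RDE P g D2 E2"
  \<comment> \<open>Each message spends one \<delta> on typicality and one on the covering excess,
    so the two together exceed the rate R2 by 4 \<delta> = \<epsilon>, which is also the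
    equivocation lost at the second stage.\<close>
  define \<delta> where "\<delta> = \<epsilon> / 4"
  have \<delta>: "0 < \<delta>" "\<epsilon> = 4 * \<delta>" using \<open>0 < \<epsilon>\<close> by (simp_all add: \<delta>_def)
  have I: "mutual_info P (marg1 Q) = R1" "mutual_info P (pair_channel Q) = R2"
    using R mutual_info_pair_markov[OF P Q markov] by (simp_all add: R1_def R2_def)
  have R1: "0 \<le> R1" unfolding R1_def by (rule RDE_nonneg[OF P feas(1)])
  have R2: "R1 \<le> R2" unfolding R1_def R2_def by (rule RDE_mono[OF P feas \<open>D2 \<le> D1\<close>])
  have E: "E1 \<le> source_entropy P - R1" "E2 \<le> source_entropy P - R2"
    using RDE_le_entropy_diff[OF P feas(1)] RDE_le_entropy_diff[OF P feas(2)] by (simp_all add: R1_def R2_def)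
  obtain \<Delta> C where "0 \<le> \<Delta>" and code: "\<forall>n M1 M2. 0 < n \<longrightarrow> 0 < M1 \<longrightarrow> 0 < M2 \<longrightarrow>
     (\<exists>(f1 :: 'a list \<Rightarrow> nat) (f2 :: 'a list \<Rightarrow> nat) (\<phi>1 :: nat \<Rightarrow> 'b list) (\<phi>2 :: nat \<Rightarrow> nat \<Rightarrow> 'b list) p.
       (\<forall>xs. f1 xs < M1 \<and> f2 xs < M2) \<and> (\<forall>w. length (\<phi>1 w) = n) \<and> (\<forall>w v. length (\<phi>2 w v) = n) \<and>
       block_dist P g n (\<lambda>xs. \<phi>1 (f1 xs)) \<le> exp_dist P (marg1 Q) g + \<delta> + \<Delta> * p \<and>
       block_dist P g n (\<lambda>xs. \<phi>2 (f1 xs) (f2 xs)) \<le> exp_dist P (marg2 Q) g + \<delta> + \<Delta> * p \<and>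
       p \<le> C / real n + exp (- (real M2 / 2 powr (real n * (R2 - R1 + \<delta>))))
           + exp (- (real M1 / 2 powr (real n * (R1 + \<delta>)))))"
    by (rule two_stage_code_exists[OF P Q \<delta>(1), of g, unfolded I])
  \<comment> \<open>The factor 2 collects the covering errors of the two layers, both with excess
    exponent \<open>\<delta>\<close> per letter.\<close>
  define err where "err n = C / real n + 2 * exp (- (2 powr (real n * \<delta>) / 2))" for n
  have "err \<longlonglongrightarrow> 0" unfolding err_def using \<delta>(1) by real_asymp
  then have "(\<lambda>n. \<Delta> * err n) \<longlonglongrightarrow> \<Delta> * 0" by (intro tendsto_intros)
  then have "\<forall>\<^sub>F n in sequentially. \<Delta> * err n < \<delta>"
    using \<delta>(1) by (intro order_tendstoD) auto
  then have "\<forall>\<^sub>F n in sequentially. 0 < n \<and> \<Delta> * err n < \<delta>"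
    using eventually_gt_at_top[of 0] by eventually_elim simp
  then show "\<forall>\<^sub>F n in sequentially. \<exists>M1 M2 f1 f2 \<phi>1 \<phi>2.
          (\<forall>xs. length xs = n \<longrightarrow> f1 xs < M1 \<and> f2 xs < M2) \<and>
          real M1 \<le> 2 powr (real n * (RDE P g D1 E1 + \<epsilon>)) \<and>
          real M2 \<le> 2 powr (real n * (RDE P g D2 E2 - RDE P g D1 E1 + \<epsilon>)) \<and>
          (\<forall>w. length (\<phi>1 w) = n) \<and> (\<forall>w v. length (\<phi>2 w v) = n) \<and>
          block_dist P g n (\<lambda>xs. \<phi>1 (f1 xs)) \<le> D1 + \<epsilon> \<and>
          block_dist P g n (\<lambda>xs. \<phi>2 (f1 xs) (f2 xs)) \<le> D2 + \<epsilon> \<and>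
          block_cond_entropy P n f1 / real n \<ge> E1 - \<epsilon> \<and>
          block_cond_entropy P n (\<lambda>xs. (f1 xs, f2 xs)) / real n \<ge> E2 - \<epsilon>"
  proof eventually_elim
    fix n assume n: "0 < n \<and> \<Delta> * err n < \<delta>"
    let ?r1 = "real n * (R1 + \<delta>)" and ?r2 = "real n * (R2 - R1 + \<delta>)" and ?t = "real n * \<delta>"
    define M1 where "M1 = nat \<lfloor>2 powr (?r1 + ?t)\<rfloor>"
    define M2 where "M2 = nat \<lfloor>2 powr (?r2 + ?t)\<rfloor>"
    have nn: "0 \<le> ?r1" "0 \<le> ?r2" "0 \<le> ?t" using R1 R2 \<delta> by auto
    note M1 = nat_floor_powr_bounds[OF nn(1) nn(3), folded M1_def]
    note M2 = nat_floor_powr_bounds[OF nn(2) nn(3), folded M2_def]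
    obtain f1 f2 :: "'a list \<Rightarrow> nat" and \<phi>1 :: "nat \<Rightarrow> 'b list" and \<phi>2 :: "nat \<Rightarrow> nat \<Rightarrow> 'b list" and p
      where f: "\<And>xs. f1 xs < M1" "\<And>xs. f2 xs < M2"
        and len: "\<forall>w. length (\<phi>1 w) = n" "\<forall>w v. length (\<phi>2 w v) = n"
        and bd: "block_dist P g n (\<lambda>xs. \<phi>1 (f1 xs)) \<le> exp_dist P (marg1 Q) g + \<delta> + \<Delta> * p"
          "block_dist P g n (\<lambda>xs. \<phi>2 (f1 xs) (f2 xs)) \<le> exp_dist P (marg2 Q) g + \<delta> + \<Delta> * p"
        and p: "p \<le> C / real n + exp (- (real M2 / 2 powr ?r2)) + exp (- (real M1 / 2 powr ?r1))"
      using code[rule_format, of n M1 M2] n M1(1) M2(1) by blast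
    have "exp (- (real M2 / 2 powr ?r2)) \<le> exp (- (2 powr ?t / 2))"
      "exp (- (real M1 / 2 powr ?r1)) \<le> exp (- (2 powr ?t / 2))"
      using M1(3) M2(3) by simp_all
    with p have "p \<le> err n" unfolding err_def by linarith
    then have "\<Delta> * p < \<delta>"
      using n \<open>0 \<le> \<Delta>\<close> mult_left_mono[of p "err n" \<Delta>] by linarith
    with bd dist \<delta> have bd': "block_dist P g n (\<lambda>xs. \<phi>1 (f1 xs)) \<le> D1 + \<epsilon>"
      "block_dist P g n (\<lambda>xs. \<phi>2 (f1 xs) (f2 xs)) \<le> D2 + \<epsilon>"
      by linarith+
    have log_M: "log 2 (real M1) \<le> ?r1 + ?t" "log 2 (real M2) \<le> ?r2 + ?t"
      using M1(1,2) M2(1,2) by (simp_all add: log_le_iff)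
    have "f1 ` words n \<subseteq> {..<M1}" using f by auto
    then have "card (f1 ` words n) \<le> M1" using card_mono[of "{..<M1}"] by simp
    from block_cond_entropy_ge[OF P this] have "real n * (source_entropy P - R1 - 2 * \<delta>) \<le> block_cond_entropy P n f1"
      using log_M(1) by (simp add: algebra_simps)
    then have "source_entropy P - R1 - 2 * \<delta> \<le> block_cond_entropy P n f1 / real n"
      using n by (simp add: le_divide_eq mult.commute)
    then have H1: "E1 - \<epsilon> \<le> block_cond_entropy P n f1 / real n"
      using E(1) \<delta> by linarith
    have "(\<lambda>xs. (f1 xs, f2 xs)) ` words n \<subseteq> {..<M1} \<times> {..<M2}" using f by auto
    then have "card ((\<lambda>xs. (f1 xs, f2 xs)) ` words n) \<le> M1 * M2"
      using card_mono[of "{..<M1} \<times> {..<M2}"] by simp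
    from block_cond_entropy_ge[OF P this]
    have "real n * (source_entropy P - R2 - 4 * \<delta>) \<le> block_cond_entropy P n (\<lambda>xs. (f1 xs, f2 xs))"
      using log_M M1(1) M2(1) by (simp add: algebra_simps log_mult)
    then have "source_entropy P - R2 - 4 * \<delta> \<le> block_cond_entropy P n (\<lambda>xs. (f1 xs, f2 xs)) / real n"
      using n by (simp add: le_divide_eq mult.commute)
    then have H2: "E2 - \<epsilon> \<le> block_cond_entropy P n (\<lambda>xs. (f1 xs, f2 xs)) / real n"
      using E(2) \<delta> by linarith
    have "?r1 + ?t \<le> real n * (R1 + \<epsilon>)" "?r2 + ?t \<le> real n * (R2 - R1 + \<epsilon>)"
      using \<delta> by (simp_all add: algebra_simps)
    then have rate: "real M1 \<le> 2 powr (real n * (R1 + \<epsilon>))" "real M2 \<le> 2 powr (real n * (R2 - R1 + \<epsilon>))"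
      using M1(2) M2(2) by (meson order_trans powr_mono one_le_numeral)+
    show "\<exists>M1 M2 f1 f2 \<phi>1 \<phi>2.
          (\<forall>xs. length xs = n \<longrightarrow> f1 xs < M1 \<and> f2 xs < M2) \<and>
          real M1 \<le> 2 powr (real n * (RDE P g D1 E1 + \<epsilon>)) \<and>
          real M2 \<le> 2 powr (real n * (RDE P g D2 E2 - RDE P g D1 E1 + \<epsilon>)) \<and>
          (\<forall>w. length (\<phi>1 w) = n) \<and> (\<forall>w v. length (\<phi>2 w v) = n) \<and>
          block_dist P g n (\<lambda>xs. \<phi>1 (f1 xs)) \<le> D1 + \<epsilon> \<and>
          block_dist P g n (\<lambda>xs. \<phi>2 (f1 xs) (f2 xs)) \<le> D2 + \<epsilon> \<and>
          block_cond_entropy P n f1 / real n \<ge> E1 - \<epsilon> \<and>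
          block_cond_entropy P n (\<lambda>xs. (f1 xs, f2 xs)) / real n \<ge> E2 - \<epsilon>"
      using f len bd' H1 H2 rate unfolding R1_def R2_def
      by (intro exI[of _ M1] exI[of _ M2] exI[of _ f1] exI[of _ f2] exI[of _ \<phi>1] exI[of _ \<phi>2]) simp
  qed
qed

theorem theorem3:
  fixes P :: "'a::finite \<Rightarrow> real" and g :: "'a \<Rightarrow> 'b::finite \<Rightarrow> real"
    and D1 E1 D2 E2 :: real
  assumes "pmf_on P"
    and "D2 < D1" and "E2 < E1"
    and "rde_feasible P g D1 E1" and "rde_feasible P g D2 E2"
  shows "successive_disclosure_achievable P g D1 E1 D2 E2 \<longleftrightarrow>
    (\<exists>Q :: 'a \<Rightarrow> 'b \<Rightarrow> 'b \<Rightarrow> real. cond_pmf2 Q \<and>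
       exp_dist P (marg1 Q) g \<le> D1 \<and> exp_dist P (marg2 Q) g \<le> D2 \<and>
       RDE P g D1 E1 = mutual_info P (marg1 Q) \<and> RDE P g D2 E2 = mutual_info P (marg2 Q) \<and>
       markov_X_Y2_Y1 P Q)"
proof
  assume "successive_disclosure_achievable P g D1 E1 D2 E2"
  from successive_disclosure_converse[OF assms(1,4,5) this] show "\<exists>Q :: 'a \<Rightarrow> 'b \<Rightarrow> 'b \<Rightarrow> real. cond_pmf2 Q \<and>
       exp_dist P (marg1 Q) g \<le> D1 \<and> exp_dist P (marg2 Q) g \<le> D2 \<and>
       RDE P g D1 E1 = mutual_info P (marg1 Q) \<and> RDE P g D2 E2 = mutual_info P (marg2 Q) \<and>
       markov_X_Y2_Y1 P Q"
    by metis
qed (use successive_disclosure_achievability[of P D2 D1 g E1 E2] assms in auto)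

end
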